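(* Let $\xi,\eta,\xi_0,\eta_0\in\mathbb{R}$. Then $$J_0\left(\tfrac12\,r(\xi,\eta,\xi_0,\eta_0)\right)=\sum_{j=1}^2\int_{-\infty}^\infty p_j(\lambda)\,u_j(\lambda,\xi)\,u_j(\lambda,i\eta)\,u_j(\lambda,\xi_0)\,u_j(\lambda,i\eta_0)\,d\lambda,$$ where $r=r(\xi,\eta,\xi_0,\eta_0)\ge0$ is given by $$r^2=\tfrac14\left[(\xi+\xi_0)^2+(\eta+\eta_0)^2\right]\left[(\xi-\xi_0)^2+(\eta-\eta_0)^2\right]$$ and $$p_1(\lambda)=\frac{1}{4\pi^3}\left|\Gamma\left(\tfrac14+\tfrac{i\lambda}{2}\right)\right|^4,\qquad p_2(\lambda)=-\frac{1}{\pi^3}\left|\Gamma\left(\tfrac34+\tfrac{i\lambda}{2}\right)\right|^4 .$$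
   Context: $J_0(z)=\sum_{n=0}^\infty\frac{(-z^2/4)^n}{(n!)^2}$ is the Bessel function of order $0$. For $\lambda,x\in\mathbb{C}$, $u_1(\lambda,x)$ and $u_2(\lambda,x)$ are the solutions (entire in $x$) of $-u''-\frac14x^2u=\lambda u$ with $u_1(\lambda,0)=u_2'(\lambda,0)=1$, $u_1'(\lambda,0)=u_2(\lambda,0)=0$. Equivalently, $$u_1(\lambda,x)=e^{-\frac{i}{4}x^2}M\left(\tfrac14+\tfrac{i}{2}\lambda,\tfrac12,\tfrac{i}{2}x^2\right),\qquad u_2(\lambda,x)=e^{-\frac{i}{4}x^2}\,x\,M\left(\tfrac34+\tfrac{i}{2}\lambda,\tfrac32,\tfrac{i}{2}x^2\right),$$ where $M(a,b,z)=\sum_{n=0}^\infty\frac{(a)_nz^n}{(b)_nn!}$ is Kummer's function. *)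

theory Defs
  imports "HOL-Complex_Analysis.Complex_Analysis"
begin

definition bessel_J0 :: "complex \<Rightarrow> complex" where
  "bessel_J0 z = (\<Sum>n. (- (z ^ 2) / 4) ^ n / (fact n) ^ 2)"

definition kummer_M :: "complex \<Rightarrow> complex \<Rightarrow> complex \<Rightarrow> complex" where
  "kummer_M a b z = (\<Sum>n. pochhammer a n * z ^ n / (pochhammer b n * fact n))"

definition osc_ivp :: "complex \<Rightarrow> complex \<Rightarrow> complex \<Rightarrow> (complex \<Rightarrow> complex) \<Rightarrow> bool" where
  "osc_ivp l c0 c1 u \<longleftrightarrow>
     u holomorphic_on UNIV \<and>
     (\<forall>x. - deriv (deriv u) x - 1 / 4 * x ^ 2 * u x = l * u x) \<and>
     u 0 = c0 \<and> deriv u 0 = c1"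

(* The descriptions are proper: existence and uniqueness are osc_ivp_osc_u1,
   osc_ivp_osc_u2 and osc_ivp_unique below. *)
definition osc_u1 :: "complex \<Rightarrow> complex \<Rightarrow> complex" where
  "osc_u1 l = (THE u. osc_ivp l 1 0 u)"

definition osc_u2 :: "complex \<Rightarrow> complex \<Rightarrow> complex" where
  "osc_u2 l = (THE u. osc_ivp l 0 1 u)"

definition weight_p1 :: "real \<Rightarrow> real" where
  "weight_p1 l = 1 / (4 * pi ^ 3) * norm (Gamma (1 / 4 + \<i> * complex_of_real l / 2)) ^ 4"

definition weight_p2 :: "real \<Rightarrow> real" where
  "weight_p2 l = - (1 / pi ^ 3) * norm (Gamma (3 / 4 + \<i> * complex_of_real l / 2)) ^ 4"


definition kummer_fps :: "complex \<Rightarrow> complex \<Rightarrow> complex fps" where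
  "kummer_fps a b = Abs_fps (\<lambda>n. pochhammer a n / (pochhammer b n * fact n))"

lemma eval_kummer_fps: "eval_fps (kummer_fps a b) z = kummer_M a b z"
  by (simp add: eval_fps_def kummer_fps_def kummer_M_def)

lemma kummer_fps_Suc:
  assumes "\<And>n. b + of_nat n \<noteq> 0"
  shows "fps_nth (kummer_fps a b) (Suc n) * ((b + of_nat n) * of_nat (Suc n))
       = (a + of_nat n) * fps_nth (kummer_fps a b) n"
proof -
  have "pochhammer b n \<noteq> 0"
  proof
    assume "pochhammer b n = 0"
    then obtain k where "b = - of_nat k" by (auto simp: pochhammer_eq_0_iff)
    then show False using assms[of k] by simp
  qed
  moreover note assms[of n]
  moreover have "A * C / (B * D * (S * F)) * (D * S) = C * (A / (B * F))"
    if "B \<noteq> 0" "D \<noteq> 0" "S \<noteq> 0" "F \<noteq> 0" for A B C D S F :: complex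
    using that by (simp add: field_simps)
  ultimately show ?thesis
    by (simp add: kummer_fps_def pochhammer_Suc del: of_nat_Suc)
qed

lemma kummer_radius:
  fixes b :: complex and r :: real
  assumes b: "b = of_real r" "r \<ge> 1 / 2"
  shows "fps_conv_radius (kummer_fps a b) = \<infinity>"
  unfolding fps_conv_radius_def
proof (rule conv_radius_inftyI'')
  fix z :: complex
  let ?c = "fps_nth (kummer_fps a b)"
  have nz: "b + of_nat n \<noteq> 0" for n
  proof -
    have "Re (b + of_nat n) > 0" using b by simp
    then show ?thesis by force
  qed
  obtain N :: nat where N: "real N \<ge> 4 * (norm a + 1) * norm z"
    using real_arch_simple by blast
  show "summable (\<lambda>n. ?c n * z ^ n)"
  proof (rule summable_ratio_test[of "1/2" N])
    fix n assume n: "n \<ge> N"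
    have e1: "norm (b + of_nat n) = r + n"
    proof -
      have "b + of_nat n = of_real (r + n)" using b by simp
      then show ?thesis using b by (simp only: norm_of_real)
    qed
    have e2: "norm (a + of_nat n) \<le> (norm a + 1) * (n + 1)"
    proof -
      have "norm (a + of_nat n) \<le> norm a + n"
        by (metis norm_of_nat norm_triangle_ineq)
      also have "\<dots> \<le> (norm a + 1) * (n + 1)" by (simp add: algebra_simps)
      finally show ?thesis .
    qed
    have "norm (?c (Suc n)) * ((r + n) * (n + 1)) = norm (a + of_nat n) * norm (?c n)"
      using arg_cong[OF kummer_fps_Suc[OF nz, where a = a and n = n], of norm]
      unfolding norm_mult e1 norm_of_nat by simp
    also have "\<dots> \<le> (norm a + 1) * (n + 1) * norm (?c n)"
      using e2 by (rule mult_right_mono) simp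
    finally have "(norm (?c (Suc n)) * (r + n)) * (n + 1) \<le> ((norm a + 1) * norm (?c n)) * (n + 1)"
      by (simp add: mult_ac)
    then have "norm (?c (Suc n)) * (r + n) \<le> (norm a + 1) * norm (?c n)"
      by (rule mult_right_le_imp_le) simp
    moreover have "norm (?c (Suc n)) * ((n + 1) / 2) \<le> norm (?c (Suc n)) * (r + n)"
      by (rule mult_left_mono) (use b in auto)
    ultimately have s1: "norm (?c (Suc n)) * (n + 1) \<le> 2 * (norm a + 1) * norm (?c n)"
      by (simp add: algebra_simps)
    have "norm (?c (Suc n)) * norm z * (n + 1) \<le> 2 * (norm a + 1) * norm (?c n) * norm z"
      using mult_right_mono[OF s1, of "norm z"] by (simp add: mult_ac)
    also have "\<dots> = (4 * (norm a + 1) * norm z) * (norm (?c n) / 2)"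
      by simp
    also have "\<dots> \<le> (n + 1) * (norm (?c n) / 2)"
      by (rule mult_right_mono) (use N n in auto)
    finally have "(norm (?c (Suc n)) * norm z) * (n + 1) \<le> (norm (?c n) / 2) * (n + 1)"
      by (simp add: mult_ac)
    then have "norm (?c (Suc n)) * norm z \<le> norm (?c n) / 2"
      by (rule mult_right_le_imp_le) simp
    from mult_right_mono[OF this, of "norm z ^ n"]
    show "norm (?c (Suc n) * z ^ Suc n) \<le> 1 / 2 * norm (?c n * z ^ n)"
      by (simp add: norm_mult norm_power mult_ac)
  qed simp
qed

lemma kummer_ode:
  fixes b :: complex and r :: real
  assumes b: "b = of_real r" "r \<ge> 1 / 2"
  obtains F' F'' where
    "\<And>z. (kummer_M a b has_field_derivative F' z) (at z)"
    "\<And>z. (F' has_field_derivative F'' z) (at z)"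
    "\<And>z. z * F'' z = a * kummer_M a b z - (b - z) * F' z"
proof -
  define f where "f = kummer_fps a b"
  have r0: "fps_conv_radius f = \<infinity>" unfolding f_def by (rule kummer_radius[OF b])
  have r1: "fps_conv_radius (fps_deriv f) = \<infinity>"
    using fps_conv_radius_deriv[of f] r0 by simp
  have r2: "fps_conv_radius (fps_deriv (fps_deriv f)) = \<infinity>"
    using fps_conv_radius_deriv[of "fps_deriv f"] r1 by simp
  have nz: "b + of_nat n \<noteq> 0" for n
  proof -
    have "Re (b + of_nat n) > 0" using b by simp
    then show ?thesis by force
  qed
  have D0: "(eval_fps f has_field_derivative eval_fps (fps_deriv f) z) (at z)" for z
    by (rule has_field_derivative_eval_fps) (simp add: r0)
  have D1: "(eval_fps (fps_deriv f) has_field_derivative eval_fps (fps_deriv (fps_deriv f)) z) (at z)" for z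
    by (rule has_field_derivative_eval_fps) (simp add: r1)
  have "z * eval_fps (fps_deriv (fps_deriv f)) z
      = a * eval_fps f z - (b - z) * eval_fps (fps_deriv f) z" for z
  proof -
    have E: "fps_X * fps_deriv (fps_deriv f) + fps_const b * fps_deriv f
        = fps_const a * f + fps_X * fps_deriv f"
    proof (rule fps_ext)
      fix n
      show "fps_nth (fps_X * fps_deriv (fps_deriv f) + fps_const b * fps_deriv f) n
          = fps_nth (fps_const a * f + fps_X * fps_deriv f) n"
        using kummer_fps_Suc[OF nz, of a n]
        by (cases n) (simp_all add: f_def algebra_simps)
    qed
    have rX: "fps_conv_radius (fps_X * g) = \<infinity>" if "fps_conv_radius g = \<infinity>" for g :: "complex fps"
      using fps_conv_radius_mult[of fps_X g] that by simp
    have rc: "fps_conv_radius (fps_const c * g) = \<infinity>" if "fps_conv_radius g = \<infinity>" for c and g :: "complex fps"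
      using fps_conv_radius_mult[of "fps_const c" g] that by simp
    show ?thesis
      using arg_cong[OF E, of "\<lambda>g. eval_fps g z"] r0 r1 r2
      by (simp add: eval_fps_add eval_fps_mult rX rc left_diff_distrib)
        (simp add: algebra_simps)
  qed
  moreover have ev: "eval_fps f = kummer_M a b"
    by (rule ext) (simp add: f_def eval_kummer_fps)
  ultimately show ?thesis
    using that[of "eval_fps (fps_deriv f)" "eval_fps (fps_deriv (fps_deriv f))", OF D0[unfolded ev] D1]
    by simp
qed

lemma kummer_M_0 [simp]: "kummer_M a b 0 = 1"
  by (simp add: eval_kummer_fps[symmetric] eval_fps_at_0 kummer_fps_def)

lemma osc_ivpI:
  assumes "\<And>x. (u has_field_derivative u' x) (at x)"
    and "\<And>x. (u' has_field_derivative - (l + x ^ 2 / 4) * u x) (at x)"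
    and "u 0 = c0" "u' 0 = c1"
  shows "osc_ivp l c0 c1 u"
proof -
  have d: "deriv u = u'" using assms(1) by (auto intro: DERIV_imp_deriv)
  have dd: "deriv u' x = - (l + x ^ 2 / 4) * u x" for x
    using assms(2) by (rule DERIV_imp_deriv)
  have "u holomorphic_on UNIV"
    using assms(1) by (meson field_differentiable_at_within field_differentiable_def holomorphic_on_def)
  then show ?thesis
    unfolding osc_ivp_def d dd using assms(3,4) by (simp add: algebra_simps)
qed

lemma osc_ivp_kummer1:
  "osc_ivp l 1 0 (\<lambda>x. exp (- \<i> / 4 * x ^ 2) * kummer_M (1 / 4 + \<i> / 2 * l) (1 / 2) (\<i> / 2 * x ^ 2))"
proof -
  define a where "a = 1 / 4 + \<i> / 2 * l"
  have b: "(1 / 2 :: complex) = of_real (1 / 2)" "(1 / 2 :: real) \<ge> 1 / 2" by simp_all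
  obtain F' F'' where
    D0 [THEN DERIV_chain2, derivative_intros]: "\<And>z. (kummer_M a (1/2) has_field_derivative F' z) (at z)" and
    D1 [THEN DERIV_chain2, derivative_intros]: "\<And>z. (F' has_field_derivative F'' z) (at z)" and
    E: "\<And>z. z * F'' z = a * kummer_M a (1/2) z - (1/2 - z) * F' z"
    using kummer_ode[OF b, of a] by metis
  let ?e = "\<lambda>x::complex. exp (- \<i> / 4 * x ^ 2)" and ?z = "\<lambda>x::complex. \<i> / 2 * x ^ 2"
  show ?thesis
    unfolding a_def[symmetric]
  proof (rule osc_ivpI[where
      u' = "\<lambda>x. ?e x * (- \<i> / 2 * x * kummer_M a (1/2) (?z x) + \<i> * x * F' (?z x))"])
    fix x
    show "((\<lambda>x. ?e x * kummer_M a (1 / 2) (?z x)) has_field_derivative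
        ?e x * (- \<i> / 2 * x * kummer_M a (1/2) (?z x) + \<i> * x * F' (?z x))) (at x)"
      by (auto intro!: derivative_eq_intros simp: algebra_simps)
    have "- (x ^ 2) * F'' (?z x) = 2 * \<i> * (?z x * F'' (?z x))"
      by (simp add: algebra_simps)
    also have "\<dots> = 2 * \<i> * (a * kummer_M a (1/2) (?z x) - (1/2 - ?z x) * F' (?z x))"
      unfolding E ..
    finally have E': "- (x ^ 2) * F'' (?z x) =
        2 * \<i> * (a * kummer_M a (1/2) (?z x) - (1/2 - ?z x) * F' (?z x))" .
    have "((\<lambda>x. ?e x * (- \<i> / 2 * x * kummer_M a (1/2) (?z x) + \<i> * x * F' (?z x)))
        has_field_derivative
        ?e x * (- (x ^ 2) / 4 * kummer_M a (1/2) (?z x) + x ^ 2 * F' (?z x)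
          - \<i> / 2 * kummer_M a (1/2) (?z x) + \<i> * F' (?z x) + - (x ^ 2) * F'' (?z x))) (at x)"
      by (auto intro!: derivative_eq_intros simp: algebra_simps power2_eq_square
          add_divide_distrib diff_divide_distrib)
    also have "?e x * (- (x ^ 2) / 4 * kummer_M a (1/2) (?z x) + x ^ 2 * F' (?z x)
          - \<i> / 2 * kummer_M a (1/2) (?z x) + \<i> * F' (?z x) + - (x ^ 2) * F'' (?z x))
        = - (l + x ^ 2 / 4) * (?e x * kummer_M a (1/2) (?z x))"
      unfolding E' a_def by (simp add: algebra_simps power2_eq_square)
    finally show "((\<lambda>x. ?e x * (- \<i> / 2 * x * kummer_M a (1/2) (?z x) + \<i> * x * F' (?z x)))
        has_field_derivative - (l + x ^ 2 / 4) * (?e x * kummer_M a (1/2) (?z x))) (at x)" .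
  qed simp_all
qed

lemma osc_ivp_kummer2:
  "osc_ivp l 0 1 (\<lambda>x. exp (- \<i> / 4 * x ^ 2) * x * kummer_M (3 / 4 + \<i> / 2 * l) (3 / 2) (\<i> / 2 * x ^ 2))"
proof -
  define a where "a = 3 / 4 + \<i> / 2 * l"
  have b: "(3 / 2 :: complex) = of_real (3 / 2)" "(3 / 2 :: real) \<ge> 1 / 2" by simp_all
  obtain F' F'' where
    D0 [THEN DERIV_chain2, derivative_intros]: "\<And>z. (kummer_M a (3/2) has_field_derivative F' z) (at z)" and
    D1 [THEN DERIV_chain2, derivative_intros]: "\<And>z. (F' has_field_derivative F'' z) (at z)" and
    E: "\<And>z. z * F'' z = a * kummer_M a (3/2) z - (3/2 - z) * F' z"
    using kummer_ode[OF b, of a] by metis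
  let ?e = "\<lambda>x::complex. exp (- \<i> / 4 * x ^ 2)" and ?z = "\<lambda>x::complex. \<i> / 2 * x ^ 2"
  let ?u' = "\<lambda>x. ?e x * (kummer_M a (3/2) (?z x) - \<i> / 2 * x ^ 2 * kummer_M a (3/2) (?z x)
      + \<i> * x ^ 2 * F' (?z x))"
  show ?thesis
    unfolding a_def[symmetric]
  proof (rule osc_ivpI[where u' = ?u'])
    fix x
    show "((\<lambda>x. ?e x * x * kummer_M a (3 / 2) (?z x)) has_field_derivative ?u' x) (at x)"
      by (auto intro!: derivative_eq_intros simp: algebra_simps power2_eq_square)
    have "- (x ^ 2) * F'' (?z x) = 2 * \<i> * (?z x * F'' (?z x))"
      by (simp add: algebra_simps)
    also have "\<dots> = 2 * \<i> * (a * kummer_M a (3/2) (?z x) - (3/2 - ?z x) * F' (?z x))"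
      unfolding E ..
    finally have E': "- (x ^ 2) * F'' (?z x) =
        2 * \<i> * (a * kummer_M a (3/2) (?z x) - (3/2 - ?z x) * F' (?z x))" .
    let ?d = "?e x * x * (- \<i> * 3 / 2 * kummer_M a (3/2) (?z x) + 3 * \<i> * F' (?z x)
          - x ^ 2 / 4 * kummer_M a (3/2) (?z x) + x ^ 2 * F' (?z x) + - (x ^ 2) * F'' (?z x))"
    have "(?u' has_field_derivative ?d) (at x)"
      by (auto intro!: derivative_eq_intros simp: algebra_simps power2_eq_square
          add_divide_distrib diff_divide_distrib)
    also have "?d = - (l + x ^ 2 / 4) * (?e x * x * kummer_M a (3/2) (?z x))"
      unfolding E' a_def by (simp add: algebra_simps power2_eq_square)
    finally show "(?u' has_field_derivative
        - (l + x ^ 2 / 4) * (?e x * x * kummer_M a (3/2) (?z x))) (at x)" .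
  qed simp_all
qed

lemma osc_ivp_derivs:
  assumes "osc_ivp l c0 c1 u"
  shows "(u has_field_derivative deriv u x) (at x)"
    and "(deriv u has_field_derivative - (l + x ^ 2 / 4) * u x) (at x)"
proof -
  have h: "u holomorphic_on UNIV"
    and e: "- deriv (deriv u) x - 1 / 4 * x ^ 2 * u x = l * u x"
    using assms by (auto simp: osc_ivp_def)
  show "(u has_field_derivative deriv u x) (at x)"
    using h by (intro holomorphic_derivI[of u UNIV]) auto
  have "deriv u holomorphic_on UNIV"
    using h by (rule holomorphic_deriv) auto
  then have "(deriv u has_field_derivative deriv (deriv u) x) (at x)"
    by (intro holomorphic_derivI[of _ UNIV]) auto
  moreover have "deriv (deriv u) x = - (l + x ^ 2 / 4) * u x"
    using e by algebra
  ultimately show "(deriv u has_field_derivative - (l + x ^ 2 / 4) * u x) (at x)"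
    by simp
qed

lemma osc_wronskian:
  assumes "osc_ivp l c0 c1 u" "osc_ivp l d0 d1 v"
  shows "u x * deriv v x - deriv u x * v x = c0 * d1 - c1 * d0"
proof -
  note [derivative_intros] = osc_ivp_derivs[OF assms(1)] osc_ivp_derivs[OF assms(2)]
  have "((\<lambda>x. u x * deriv v x - deriv u x * v x) has_field_derivative 0) (at x)" for x
    by (auto intro!: derivative_eq_intros simp: algebra_simps)
  then obtain c where c: "u x * deriv v x - deriv u x * v x = c" for x
    using has_field_derivative_zero_constant[of UNIV "\<lambda>x. u x * deriv v x - deriv u x * v x"] by auto
  show ?thesis using c[of x] c[of 0] assms by (simp add: osc_ivp_def)
qed

lemma osc_ivp_unique:
  assumes "osc_ivp l c0 c1 u" "osc_ivp l c0 c1 v"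
  shows "u = v"
proof -
  obtain f g where f: "osc_ivp l 1 0 f" and g: "osc_ivp l 0 1 g"
    using osc_ivp_kummer1 osc_ivp_kummer2 by blast
  have rep: "w x = c0 * f x + c1 * g x" if w: "osc_ivp l c0 c1 w" for w x
  proof -
    have "f x * deriv g x - deriv f x * g x = 1"
      using osc_wronskian[OF f g, of x] by simp
    moreover have "w x * deriv g x - deriv w x * g x = c0"
      using osc_wronskian[OF w g, of x] by simp
    moreover have "w x * deriv f x - deriv w x * f x = - c1"
      using osc_wronskian[OF w f, of x] by simp
    ultimately show ?thesis by algebra
  qed
  show ?thesis using rep[OF assms(1)] rep[OF assms(2)] by auto
qed

lemma osc_ivp_osc_u1: "osc_ivp l 1 0 (osc_u1 l)"
  unfolding osc_u1_def
  by (rule theI[of "osc_ivp l 1 0", OF osc_ivp_kummer1]) (rule osc_ivp_unique[OF _ osc_ivp_kummer1])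

lemma osc_ivp_osc_u2: "osc_ivp l 0 1 (osc_u2 l)"
  unfolding osc_u2_def
  by (rule theI[of "osc_ivp l 0 1", OF osc_ivp_kummer2]) (rule osc_ivp_unique[OF _ osc_ivp_kummer2])

lemma osc_u1_kummer:
  "osc_u1 l x = exp (- \<i> / 4 * x ^ 2) * kummer_M (1 / 4 + \<i> / 2 * l) (1 / 2) (\<i> / 2 * x ^ 2)"
  using osc_ivp_unique[OF osc_ivp_osc_u1 osc_ivp_kummer1] by metis

lemma osc_u2_kummer:
  "osc_u2 l x = exp (- \<i> / 4 * x ^ 2) * x * kummer_M (3 / 4 + \<i> / 2 * l) (3 / 2) (\<i> / 2 * x ^ 2)"
  using osc_ivp_unique[OF osc_ivp_osc_u2 osc_ivp_kummer2] by metis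

end

theory Submission
  imports Defs "HOL-Probability.Characteristic_Functions" "HOL-Probability.Sinc_Integral"
begin

text \<open>
  For fixed \<open>\<xi>\<close>, \<open>\<eta>\<close> the kernel
  \<open>k(y) = sech(y)^(1/2) exp(i ((\<xi>^2 - \<eta>^2)/4 tanh y + \<xi>\<eta>/2 sech y))\<close>
  satisfies \<open>k_{\<eta>\<eta>} + (\<eta>^2/4) k = i k_y = - k_{\<xi>\<xi>} - (\<xi>^2/4) k\<close>. Hence its Fourier transform
  in \<open>y\<close> at frequency \<open>\<lambda>\<close> solves the oscillator equation in \<open>\<xi>\<close> and in \<open>i\<eta>\<close>, so that it equals
  \<open>C1(\<lambda>) u1(\<lambda>,\<xi>) u1(\<lambda>,i\<eta>) + C2(\<lambda>)/2 u2(\<lambda>,\<xi>) u2(\<lambda>,i\<eta>)\<close>, where \<open>C1\<close> and \<open>C2\<close> are the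
  transforms of \<open>sech^(1/2)\<close> and \<open>sech^(3/2)\<close>; these are Beta integrals and give the Gamma factors.
  Adding Parseval's identity for \<open>(\<xi>,\<eta>)\<close>, \<open>(\<xi>0,\<eta>0)\<close> to the one for \<open>(\<xi>,-\<eta>)\<close>, \<open>(\<xi>0,-\<eta>0)\<close> cancels the
  mixed products. With \<open>tanh y = sin \<theta>\<close> the other side becomes the integral of
  \<open>exp(i (a sin \<theta> + b cos \<theta>))\<close> over a full period, which is \<open>2\<pi> J0((a^2 + b^2)^(1/2))\<close>.
\<close>

section \<open>Integrals over the real line\<close>

text \<open>The substitution rule for absolutely integrable functions is carried over to Bochner
  integrals on \<open>lborel\<close>. Positivity of \<open>h\<close> makes \<open>g\<close> strictly
  increasing, hence injective, and removes the absolute value of the Jacobian. Borel measurability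
  is assumed because integrability over \<open>lebesgue\<close> passes to \<open>lborel\<close> only
  for Borel functions.\<close>

lemma lborel_change_of_variables:
  fixes f :: "real \<Rightarrow> 'a::euclidean_space" and g h :: "real \<Rightarrow> real"
  assumes der: "\<And>x. (g has_real_derivative h x) (at x)"
    and pos: "\<And>x. h x > 0"
    and f: "f absolutely_integrable_on range g"
    and meas: "(\<lambda>x. h x *\<^sub>R f (g x)) \<in> borel_measurable borel"
  shows "integrable lborel (\<lambda>x. h x *\<^sub>R f (g x))"
    and "(LINT x|lborel. h x *\<^sub>R f (g x)) = integral (range g) f"
proof -
  have "strict_mono g"
    unfolding strict_mono_def using DERIV_pos_imp_increasing[of _ _ g] der pos by blast
  then have inj: "inj_on g UNIV" by (rule strict_mono_imp_inj_on)
  have "(\<lambda>x. \<bar>h x\<bar> *\<^sub>R f (g x)) absolutely_integrable_on UNIV \<and>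
      integral UNIV (\<lambda>x. \<bar>h x\<bar> *\<^sub>R f (g x)) = integral (range g) f"
    using has_absolute_integral_change_of_variables_real[of UNIV g h f "integral (range g) f"] der inj f
    by simp
  then have *: "integrable lebesgue (\<lambda>x. h x *\<^sub>R f (g x))"
    "integral UNIV (\<lambda>x. h x *\<^sub>R f (g x)) = integral (range g) f"
    using pos by (simp_all add: set_integrable_def abs_of_pos)
  show I: "integrable lborel (\<lambda>x. h x *\<^sub>R f (g x))"
    using *(1) meas by (simp add: integrable_completion)
  show "(LINT x|lborel. h x *\<^sub>R f (g x)) = integral (range g) f"
    using *(2) integral_lborel[OF I] by simp
qed

lemma exp_mult_has_vector_derivative:
  fixes w :: complex
  shows "((\<lambda>t. exp (w * of_real t)) has_vector_derivative w * exp (w * of_real t)) (at t within S)"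
  by (rule has_vector_derivative_real_field[where f = "\<lambda>z. exp (w * z)"])
    (auto intro!: derivative_eq_intros simp: mult.commute)

text \<open>The fundamental theorem on the whole line, in the form needed for integration by parts
  without boundary terms.\<close>

lemma integral_derivative_eq_0:
  fixes F f :: "real \<Rightarrow> 'a::euclidean_space"
  assumes "\<And>x. (F has_vector_derivative f x) (at x)"
    and "continuous_on UNIV f" "integrable lborel f"
    and "(F \<longlongrightarrow> 0) at_top" "(F \<longlongrightarrow> 0) at_bot"
  shows "(LINT x|lborel. f x) = 0"
proof -
  have "(LBINT x=-\<infinity>..\<infinity>. f x) = 0 - 0"
    using assms
    by (intro interval_integral_FTC_integrable[where F = F])
      (auto simp: ereal_tendsto_simps set_integrable_def continuous_on_eq_continuous_at)
  then show ?thesis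
    by (simp add: interval_integral_to_infinity_eq interval_lebesgue_integral_def set_lebesgue_integral_def)
qed

text \<open>Dominated convergence is applied to the remainder of the linear approximation divided by
  \<open>norm (x - x0)\<close>. The mean value inequality on the unit ball about \<open>x0\<close>
  bounds this quotient by \<open>2 * w y\<close>, so a bound on \<open>F'\<close> that is uniform
  near \<open>x0\<close> suffices.\<close>

lemma has_vector_derivative_integral_dominated:
  fixes F :: "real \<Rightarrow> 'b \<Rightarrow> 'a::euclidean_space"
  assumes int: "\<And>x. integrable M (F x)"
    and der: "\<And>x y. ((\<lambda>x. F x y) has_vector_derivative F' x y) (at x)"
    and dom: "\<And>x y. \<bar>x - x0\<bar> \<le> 1 \<Longrightarrow> norm (F' x y) \<le> w y"
    and w: "integrable M w"
    and int': "integrable M (F' x0)"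
  shows "((\<lambda>x. LINT y|M. F x y) has_vector_derivative (LINT y|M. F' x0 y)) (at x0)"
proof -
  let ?S = "cball x0 1"
  let ?R = "\<lambda>x y. (1 / norm (x - x0)) *\<^sub>R (F x y - (F x0 y + (x - x0) *\<^sub>R F' x0 y))"
  have lim0: "((\<lambda>x. ?R x y) \<longlongrightarrow> 0) (at x0 within ?S)" for y
    using has_vector_derivative_at_within[OF der[of y x0], of ?S]
    unfolding has_vector_derivative_def has_derivative_within by blast
  have bound: "norm (?R x y) \<le> 2 * w y" if x: "x \<in> ?S" "x \<noteq> x0" for x y
  proof -
    have "norm (F x y - F x0 y) \<le> w y * norm (x - x0)"
    proof (rule differentiable_bound[where S = ?S and f' = "\<lambda>x h. h *\<^sub>R F' x y"])
      show "((\<lambda>x. F x y) has_derivative (\<lambda>h. h *\<^sub>R F' z y)) (at z within ?S)" for z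
        using has_vector_derivative_at_within[OF der[of y z], of ?S] by (simp add: has_vector_derivative_def)
      show "onorm (\<lambda>h. h *\<^sub>R F' z y) \<le> w y" if "z \<in> ?S" for z
      proof (rule onorm_le)
        show "norm (h *\<^sub>R F' z y) \<le> w y * norm h" for h :: real
          using mult_left_mono[OF dom[of z y], of "\<bar>h\<bar>"] that
          by (simp add: dist_real_def abs_minus_commute mult.commute)
      qed
    qed (use x in auto)
    moreover have "norm ((x - x0) *\<^sub>R F' x0 y) \<le> w y * norm (x - x0)"
      using mult_left_mono[OF dom[of x0 y], of "\<bar>x - x0\<bar>"] by (simp add: mult.commute)
    ultimately have "norm (F x y - F x0 y - (x - x0) *\<^sub>R F' x0 y) \<le> 2 * w y * norm (x - x0)"
      by (smt (verit) norm_triangle_ineq4 left_diff_distrib')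
    moreover have pos: "norm (x - x0) > 0"
      using x by simp
    moreover have "norm (?R x y) = norm (F x y - F x0 y - (x - x0) *\<^sub>R F' x0 y) / norm (x - x0)"
      by (simp add: diff_diff_add)
    ultimately show ?thesis
      using pos by (simp only: pos_divide_le_eq)
  qed
  have "((\<lambda>x. LINT y|M. ?R x y) \<longlongrightarrow> (LINT y|M. 0)) (at x0 within ?S)"
    unfolding tendsto_at_iff_sequentially
  proof (intro allI impI)
    fix X :: "nat \<Rightarrow> real"
    assume X: "\<forall>i. X i \<in> ?S - {x0}" "X \<longlonglongrightarrow> x0"
    have "(\<lambda>n. LINT y|M. ?R (X n) y) \<longlonglongrightarrow> (LINT y|M. 0)"
    proof (rule integral_dominated_convergence[where w = "\<lambda>y. 2 * w y"])
      show "(\<lambda>y. ?R (X n) y) \<in> borel_measurable M" for n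
        using int int' by (intro borel_measurable_scaleR borel_measurable_diff borel_measurable_add) auto
      show "AE y in M. (\<lambda>n. ?R (X n) y) \<longlonglongrightarrow> 0"
        using lim0 X unfolding tendsto_at_iff_sequentially o_def by auto
      show "AE y in M. norm (?R (X n) y) \<le> 2 * w y" for n
        using bound X by blast
    qed (use w in auto)
    then show "((\<lambda>x. LINT y|M. ?R x y) \<circ> X) \<longlonglongrightarrow> (LINT y|M. 0)"
      by (simp add: o_def)
  qed
  moreover have "(LINT y|M. ?R x y) = (1 / norm (x - x0)) *\<^sub>R
      ((LINT y|M. F x y) - ((LINT y|M. F x0 y) + (x - x0) *\<^sub>R (LINT y|M. F' x0 y)))" for x
    using int int' by simp
  ultimately have "((\<lambda>x. LINT y|M. F x y) has_derivative (\<lambda>h. h *\<^sub>R (LINT y|M. F' x0 y))) (at x0 within ?S)"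
    unfolding has_derivative_within by (simp only: bounded_linear_scaleR_left Bochner_Integration.integral_zero)
  then show ?thesis
    unfolding has_vector_derivative_def
    by (metis at_within_interior centre_in_ball interior_cball zero_less_one)
qed

section \<open>The Gudermannian substitution \<open>t = arctan (sinh x)\<close>\<close>

lemma range_arctan_sinh: "range (\<lambda>x::real. arctan (sinh x)) = {-pi/2<..<pi/2}"
proof safe
  fix x :: real
  show "arctan (sinh x) \<in> {-pi/2<..<pi/2}"
    using arctan_lbound[of "sinh x"] arctan_ubound[of "sinh x"] by simp
next
  fix t :: real
  assume "t \<in> {-pi/2<..<pi/2}"
  then have "t = arctan (sinh (arsinh (tan t)))"
    by (simp add: arctan_tan)
  then show "t \<in> range (\<lambda>x. arctan (sinh x))"
    by blast
qed

lemma arctan_sinh_has_derivative: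
  "((\<lambda>x::real. arctan (sinh x)) has_real_derivative 1 / cosh x) (at x)"
proof -
  have e: "1 + (sinh x)\<^sup>2 = (cosh x)\<^sup>2"
    using cosh_square_eq[of x] by simp
  have "cosh x * inverse (1 + (sinh x)\<^sup>2) = 1 / cosh x"
    unfolding e using cosh_real_pos[of x] by (simp add: field_simps power2_eq_square)
  then show ?thesis
    by (auto intro!: derivative_eq_intros simp: mult.commute)
qed

lemma sqrt_one_plus_sinh_square: "sqrt (1 + (sinh x)\<^sup>2) = cosh (x::real)"
  using cosh_square_eq[of x] by (simp add: real_sqrt_unique add.commute)

lemma sin_arctan_sinh: "sin (arctan (sinh x)) = tanh (x::real)"
  and cos_arctan_sinh: "cos (arctan (sinh x)) = 1 / cosh (x::real)"
  by (simp_all add: sin_arctan cos_arctan sqrt_one_plus_sinh_square tanh_def)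

text \<open>The Gudermannian function has derivative \<open>1 / cosh x\<close>, and its sine and
  cosine are \<open>tanh x\<close> and \<open>1 / cosh x\<close>. It maps the line onto the open
  interval; the two endpoints do not affect the integral.\<close>

lemma sech_substitution:
  fixes F :: "real \<Rightarrow> real \<Rightarrow> 'a::euclidean_space"
  assumes F: "continuous_on UNIV (\<lambda>(x, y). F x y)"
  shows "integrable lborel (\<lambda>x. (1 / cosh x) *\<^sub>R F (tanh x) (1 / cosh x))"
    and "(LINT x|lborel. (1 / cosh x) *\<^sub>R F (tanh x) (1 / cosh x))
      = integral {-pi/2..pi/2} (\<lambda>t. F (sin t) (cos t))"
proof -
  have c: "continuous_on S (\<lambda>t. F (u t) (v t))" if "continuous_on S u" "continuous_on S v"
    for S :: "real set" and u v
    using continuous_on_compose2[OF F, of S "\<lambda>t. (u t, v t)"] that by (auto intro!: continuous_intros)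
  have "(\<lambda>t. F (sin t) (cos t)) absolutely_integrable_on {-pi/2..pi/2}"
    by (intro absolutely_integrable_continuous_real c continuous_intros)
  then have ai: "(\<lambda>t. F (sin t) (cos t)) absolutely_integrable_on range (\<lambda>x. arctan (sinh x))"
    unfolding range_arctan_sinh by (rule set_integrable_subset) auto
  have m: "(\<lambda>x. (1 / cosh x) *\<^sub>R F (sin (arctan (sinh x))) (cos (arctan (sinh x)))) \<in> borel_measurable borel"
    by (intro borel_measurable_continuous_onI continuous_intros c) auto
  note * = lborel_change_of_variables[where f = "\<lambda>t. F (sin t) (cos t)",
      OF arctan_sinh_has_derivative _ ai m, unfolded sin_arctan_sinh cos_arctan_sinh]
  show "integrable lborel (\<lambda>x. (1 / cosh x) *\<^sub>R F (tanh x) (1 / cosh x))"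
    by (rule *) simp
  have "(LINT x|lborel. (1 / cosh x) *\<^sub>R F (tanh x) (1 / cosh x))
      = integral {-pi/2<..<pi/2} (\<lambda>t. F (sin t) (cos t))"
    by (subst *(2)) (simp_all add: range_arctan_sinh)
  then show "(LINT x|lborel. (1 / cosh x) *\<^sub>R F (tanh x) (1 / cosh x))
      = integral {-pi/2..pi/2} (\<lambda>t. F (sin t) (cos t))"
    by (simp add: integral_open_interval_real)
qed

lemma integrable_sech: "integrable lborel (\<lambda>x::real. 1 / cosh x)"
  using sech_substitution(1)[of "\<lambda>x y. 1 :: real"] by simp

text \<open>The dominating function is \<open>1 / cosh (x / 2)\<close>, since
  \<open>cosh (x / 2) ^ 2 = (cosh x + 1) / 2 <= cosh x\<close>.\<close>

lemma integrable_inverse_sqrt_cosh: "integrable lborel (\<lambda>x::real. 1 / sqrt (cosh x))"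
proof (rule Bochner_Integration.integrable_bound)
  show "integrable lborel (\<lambda>x::real. 1 / cosh (x / 2))"
    using lborel_integrable_real_affine[OF integrable_sech, of "1/2" 0] by simp
  show "(\<lambda>x::real. 1 / sqrt (cosh x)) \<in> borel_measurable lborel"
    by (simp, intro borel_measurable_continuous_onI continuous_intros) auto
  have "norm (1 / sqrt (cosh x)) \<le> norm (1 / cosh (x / 2))" for x :: real
  proof -
    have "(cosh (x / 2))\<^sup>2 = (cosh x + 1) / 2"
      using cosh_double_cosh[of "x / 2"] by simp
    also have "\<dots> \<le> cosh x"
      using cosh_real_ge_1[of x] by simp
    finally have "cosh (x / 2) \<le> sqrt (cosh x)"
      by (rule real_le_rsqrt)
    then show ?thesis
      by (simp add: frac_le)
  qed
  then show "AE x in lborel. norm (1 / sqrt (cosh x)) \<le> norm (1 / cosh (x / 2 :: real))"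
    by simp
qed

section \<open>The Gamma function and powers of cosh\<close>

text \<open>Euler's integral under \<open>t = exp p\<close>. In this form a rescaling of
  \<open>t\<close> becomes a translation of \<open>p\<close>.\<close>

lemma log_Gamma_integral:
  assumes a: "Re a > 0"
  shows "integrable lborel (\<lambda>p::real. exp (a * of_real p - of_real (exp p)))"
    and "(LINT p|lborel. exp (a * of_real p - of_real (exp p))) = Gamma a"
proof -
  let ?f = "\<lambda>t. complex_of_real t powr (a - 1) / of_real (exp t)"
  have r: "range (exp :: real \<Rightarrow> real) = {0<..}"
    by (auto simp: image_iff) (metis exp_ln)
  have eq: "exp p *\<^sub>R ?f (exp p) = exp (a * of_real p - of_real (exp p))" for p :: real
  proof -
    have "Ln (complex_of_real (exp p)) = of_real p"
      using Ln_of_real[of "exp p"] by simp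
    then have "exp p *\<^sub>R ?f (exp p) = exp (of_real p) * exp ((a - 1) * of_real p) / exp (of_real (exp p))"
      by (simp add: powr_def scaleR_conv_of_real exp_of_real)
    also have "\<dots> = exp (a * of_real p - of_real (exp p))"
      by (simp add: exp_add[symmetric] exp_diff[symmetric] algebra_simps)
    finally show ?thesis .
  qed
  have ai: "?f absolutely_integrable_on range exp"
    unfolding r by (rule absolutely_integrable_Gamma_integral'[OF a])
  have m: "(\<lambda>p. exp p *\<^sub>R ?f (exp p)) \<in> borel_measurable borel"
    unfolding eq by (intro borel_measurable_continuous_onI continuous_intros)
  note * = lborel_change_of_variables[where g = exp and h = exp, OF DERIV_exp _ ai m, unfolded eq]
  show "integrable lborel (\<lambda>p::real. exp (a * of_real p - of_real (exp p)))"
    by (rule *) simp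
  show "(LINT p|lborel. exp (a * of_real p - of_real (exp p))) = Gamma a"
    using *(2) integral_unique[OF Gamma_integral_complex'[OF a]] by (simp add: r)
qed

text \<open>Multiplying the two logarithmic Gamma integrals and passing to the variables
  \<open>z = (p + q) / 2\<close>, \<open>y = (p - q) / 2\<close> separates the integrand into a Gamma integral
  in \<open>z\<close> and a power of \<open>cosh y\<close>.\<close>
lemma Gamma_mult_eq_cosh_integral:
  fixes s l :: real
  assumes s: "s > 0"
  defines "a \<equiv> of_real (s / 2) + \<i> * of_real (l / 2)"
  shows "Gamma a * Gamma (cnj a) =
    2 * Gamma (of_real s) * (LINT y|lborel. exp (\<i> * of_real (l * y)) * of_real ((2 * cosh y) powr - s))"
proof -
  have ra: "Re a > 0" "Re (cnj a) > 0" "Re (complex_of_real s) > 0"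
    using s by (simp_all add: a_def)
  define f g where "f p = exp (a * of_real p - of_real (exp p))"
    and "g p = exp (cnj a * of_real p - of_real (exp p))" for p :: real
  have f: "integrable lborel f" "integral\<^sup>L lborel f = Gamma a"
    and g: "integrable lborel g" "integral\<^sup>L lborel g = Gamma (cnj a)"
    unfolding f_def g_def using log_Gamma_integral ra by auto
  \<comment> \<open>The second variable is \<open>q = p - 2 * y\<close>; its Jacobian produces the
    factor 1/2.\<close>
  have gg: "(LINT y|lborel. g (p + (- 2) * y)) = Gamma (cnj a) / 2"
    "(LINT y|lborel. norm (g (p + (- 2) * y))) = (LINT y|lborel. norm (g y)) / 2"
    "integrable lborel (\<lambda>y. g (p + (- 2) * y))" for p
    using lborel_integral_real_affine[of "-2" g p] lborel_integral_real_affine[of "-2" "\<lambda>x. norm (g x)" p]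
      lborel_integrable_real_affine[OF g(1), of "-2" p]
    by (simp_all add: g(2) scaleR_conv_of_real)
  have I: "integrable (lborel \<Otimes>\<^sub>M lborel) (\<lambda>(p, y). f p * g (p + (- 2) * y))"
  proof (rule lborel_pair.Fubini_integrable)
    have "continuous_on UNIV (\<lambda>z. f (fst z) * g (fst z + (- 2) * snd z))"
      unfolding f_def g_def by (intro continuous_intros)
    then show "(\<lambda>(p, y). f p * g (p + (- 2) * y)) \<in> borel_measurable (lborel \<Otimes>\<^sub>M lborel)"
      unfolding lborel_prod by (simp add: borel_measurable_continuous_onI case_prod_unfold)
    show "integrable lborel (\<lambda>x. LINT y|lborel. norm (case (x, y) of (p, y) \<Rightarrow> f p * g (p + (- 2) * y)))"
      using f(1) by (simp only: prod.case norm_mult integral_mult_right_zero gg(2)) simp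
    show "AE x in lborel. integrable lborel (\<lambda>y. case (x, y) of (p, y) \<Rightarrow> f p * g (p + (- 2) * y))"
      using gg(3) by simp
  qed
  have inner: "(LINT p|lborel. f p * g (p + (- 2) * y))
      = exp (\<i> * of_real (l * y)) * (Gamma (of_real s) * of_real ((2 * cosh y) powr - s))" for y
  proof -
    define c where "c = 2 * cosh y"
    have c: "c > 0" by (simp add: c_def)
    \<comment> \<open>For \<open>p = y + z\<close> and \<open>q = z - y\<close> the two inner
      exponentials add up to \<open>2 * cosh y * exp z\<close>, while \<open>a + cnj a = s\<close>
      and \<open>a - cnj a = \<i> * l\<close>.\<close>
    have e1: "f (y + z) * g (y + z + (- 2) * y)
        = exp (\<i> * of_real (l * y)) * exp (of_real s * of_real z - of_real (c * exp z))" for z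
    proof -
      have "exp (y + z) + exp (z - y) = c * exp z"
        by (simp add: c_def cosh_def exp_add exp_diff exp_minus field_simps)
      then have "complex_of_real (exp (y + z)) + of_real (exp (z - y)) = of_real (c * exp z)"
        unfolding of_real_add[symmetric] by (rule arg_cong)
      moreover have "a * of_real (y + z) + cnj a * of_real (z - y)
          = \<i> * of_real (l * y) + of_real s * of_real z"
        by (simp add: a_def field_simps)
      moreover have "f (y + z) * g (z - y) = exp (a * of_real (y + z) + cnj a * of_real (z - y)
          - (of_real (exp (y + z)) + of_real (exp (z - y))))"
        by (simp add: f_def g_def exp_add[symmetric] algebra_simps)
      ultimately show ?thesis
        by (simp add: exp_add[symmetric] exp_diff algebra_simps)
    qed
    \<comment> \<open>Translating \<open>z\<close> by \<open>- ln c\<close> absorbs the factor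
      \<open>c\<close> of \<open>exp z\<close> and releases \<open>c powr - s\<close>.\<close>
    have e2: "exp (of_real s * of_real (- ln c + z) - of_real (c * exp (- ln c + z)))
        = of_real (c powr - s) * exp (of_real s * of_real z - complex_of_real (exp z))" for z
    proof -
      have "c * exp (- ln c + z) = exp z"
        using c by (simp add: exp_diff)
      moreover have "complex_of_real (c powr - s) = exp (of_real (- s * ln c))"
        using c unfolding exp_of_real by (simp add: powr_def)
      ultimately show ?thesis
        by (simp add: exp_add[symmetric] algebra_simps)
    qed
    have "(LINT p|lborel. f p * g (p + (- 2) * y)) = (LINT z|lborel. f (y + z) * g (y + z + (- 2) * y))"
      using lborel_integral_real_affine[of 1 "\<lambda>p. f p * g (p + (- 2) * y)" y] by simp
    also have "\<dots> = exp (\<i> * of_real (l * y)) *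
        (LINT z|lborel. exp (of_real s * of_real z - of_real (c * exp z)))"
      unfolding e1 by simp
    also have "(LINT z|lborel. exp (complex_of_real s * of_real z - of_real (c * exp z)))
        = (LINT z|lborel. exp (of_real s * of_real (- ln c + z) - of_real (c * exp (- ln c + z))))"
      using lborel_integral_real_affine[of 1 "\<lambda>z. exp (complex_of_real s * of_real z - of_real (c * exp z))" "- ln c"]
      by simp
    also have "\<dots> = of_real (c powr - s) * Gamma (of_real s)"
      unfolding e2 using log_Gamma_integral(2)[OF ra(3)] by simp
    finally show ?thesis
      by (simp add: c_def)
  qed
  \<comment> \<open>Integrating over \<open>y\<close> first splits the double integral into the two
    Gamma values; integrating over \<open>p\<close> first gives \<open>inner\<close>.\<close>
  have "Gamma a * Gamma (cnj a) / 2 = (LINT p|lborel. (LINT y|lborel. f p * g (p + (- 2) * y)))"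
    by (simp only: integral_mult_right_zero integral_mult_left_zero gg(1) f(2)) simp
  also have "\<dots> = (LINT y|lborel. (LINT p|lborel. f p * g (p + (- 2) * y)))"
    by (rule lborel_pair.Fubini_integral[OF I, symmetric])
  also have "\<dots> = Gamma (of_real s) *
      (LINT y|lborel. exp (\<i> * of_real (l * y)) * of_real ((2 * cosh y) powr - s))"
    unfolding inner by (simp add: mult.left_commute)
  finally show ?thesis
    by simp
qed

text \<open>\<open>Gamma\<close> commutes with conjugation, so the product in
  \<open>Gamma_mult_eq_cosh_integral\<close> is a squared modulus. Pulling the 2 out of
  \<open>(2 * cosh y) powr - s\<close> accounts for \<open>2 powr s\<close>.\<close>

lemma cosh_integral_eq_norm_Gamma:
  fixes s l :: real
  assumes s: "s > 0"
  shows "(LINT y|lborel. exp (\<i> * of_real (l * y)) * of_real (cosh y powr - s))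
    = of_real (2 powr s / (2 * Gamma s) * norm (Gamma (of_real (s / 2) + \<i> * of_real (l / 2))) ^ 2)"
proof -
  let ?a = "of_real (s / 2) + \<i> * of_real (l / 2)"
  let ?I = "LINT y|lborel. exp (\<i> * of_real (l * y)) * complex_of_real (cosh y powr - s)"
  have G: "Gamma s > 0"
    using s by (rule Gamma_real_pos)
  have "(2 * cosh y) powr - s = 2 powr - s * cosh y powr - s" for y :: real
    by (simp add: powr_mult)
  then have "Gamma ?a * Gamma (cnj ?a) = 2 * of_real (Gamma s) * (of_real (2 powr - s) * ?I)"
    using Gamma_mult_eq_cosh_integral[OF s, of l] by (simp add: Gamma_complex_of_real mult.left_commute)
  moreover have "Gamma ?a * Gamma (cnj ?a) = of_real (norm (Gamma ?a) ^ 2)"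
    unfolding cnj_Gamma[symmetric] by (rule complex_norm_square[symmetric])
  ultimately have "of_real (norm (Gamma ?a) ^ 2) = of_real (2 * Gamma s * 2 powr - s) * ?I"
    by (simp only: of_real_mult of_real_numeral mult.assoc)
  moreover have "2 powr s / (2 * Gamma s) * (2 * Gamma s * 2 powr - s) = 1"
    using G by (simp add: powr_minus)
  then have "?I = of_real (2 powr s / (2 * Gamma s)) * (of_real (2 * Gamma s * 2 powr - s) * ?I)"
    unfolding mult.assoc[symmetric] of_real_mult[symmetric] by simp
  ultimately show ?thesis
    by (simp only: of_real_mult)
qed

lemma Gamma_three_halves: "Gamma (3 / 2 :: real) = sqrt pi / 2"
proof -
  have "(1 / 2 :: real) \<notin> \<int>\<^sub>\<le>\<^sub>0"
    by (auto elim!: nonpos_Ints_cases)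
  then show ?thesis
    using Gamma_plus1[of "1 / 2 :: real"] Gamma_one_half_real by simp
qed

section \<open>Bessel's integral\<close>

lemma integral_exp_int:
  fixes m :: int
  shows "integral {-pi..pi} (\<lambda>t. exp (\<i> * of_int m * of_real t)) = (if m = 0 then 2 * of_real pi else 0)"
proof (cases "m = 0")
  case False
  let ?F = "\<lambda>t::real. exp (\<i> * of_int m * of_real t) / (\<i> * of_int m)"
  have "((\<lambda>t. exp (\<i> * of_int m * of_real t)) has_integral ?F pi - ?F (-pi)) {-pi..pi}"
  proof (rule fundamental_theorem_of_calculus)
    show "(?F has_vector_derivative exp (\<i> * of_int m * of_real t)) (at t within {-pi..pi})" for t
      using has_vector_derivative_divide[OF exp_mult_has_vector_derivative[of "\<i> * of_int m" t "{-pi..pi}"], of "\<i> * of_int m"]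
        False by simp
  qed simp
  moreover have "exp (\<i> * of_int m * of_real pi) = exp (\<i> * of_int m * of_real (- pi))"
    unfolding exp_eq by (intro exI[of _ m]) (simp add: algebra_simps)
  ultimately show ?thesis
    using False by (simp add: integral_unique)
qed (simp add: scaleR_conv_of_real)

text \<open>On a compact interval \<open>f\<close> and \<open>g\<close> are bounded, so the
  exponential series converges uniformly by the Weierstrass test and may be integrated term by
  term.\<close>

lemma integral_mult_exp_sums:
  fixes f g :: "real \<Rightarrow> complex"
  assumes f: "continuous_on {a..b} f" and g: "continuous_on {a..b} g"
  shows "(\<lambda>n. integral {a..b} (\<lambda>t. f t * (g t ^ n / fact n))) sums integral {a..b} (\<lambda>t. f t * exp (g t))"
proof -
  obtain B where B: "norm (f t) \<le> B" if "t \<in> {a..b}" for t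
    using compact_imp_bounded[OF compact_continuous_image[OF f compact_Icc]] unfolding bounded_iff by blast
  obtain C where C: "norm (g t) \<le> C" if "t \<in> {a..b}" for t
    using compact_imp_bounded[OF compact_continuous_image[OF g compact_Icc]] unfolding bounded_iff by blast
  have "uniform_limit {a..b} (\<lambda>n t. \<Sum>i<n. f t * (g t ^ i / fact i)) (\<lambda>t. \<Sum>i. f t * (g t ^ i / fact i)) sequentially"
  proof (rule Weierstrass_m_test)
    show "norm (f t * (g t ^ n / fact n)) \<le> B * (C ^ n / fact n)" if "t \<in> {a..b}" for n t
    proof -
      have "norm (f t) \<le> B" "norm (g t) \<le> C"
        using B C that by auto
      then show ?thesis
        unfolding norm_mult norm_divide norm_power norm_fact
        by (intro mult_mono divide_right_mono power_mono) (auto intro: order_trans[OF norm_ge_zero])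
    qed
    show "summable (\<lambda>n. B * (C ^ n / fact n))"
      using summable_exp_generic[of C] by (intro summable_mult) (simp add: field_simps)
  qed
  moreover have "(\<Sum>i. f t * (g t ^ i / fact i)) = f t * exp (g t)" for t
    using sums_mult[OF exp_converges[of "g t"], of "f t"]
    by (simp add: sums_iff scaleR_conv_of_real field_simps)
  ultimately have "uniform_limit {a..b} (\<lambda>n t. \<Sum>i<n. f t * (g t ^ i / fact i)) (\<lambda>t. f t * exp (g t)) sequentially"
    by simp
  then obtain I J where IJ: "\<And>n. ((\<lambda>t. \<Sum>i<n. f t * (g t ^ i / fact i)) has_integral I n) {a..b}"
    "((\<lambda>t. f t * exp (g t)) has_integral J) {a..b}" "I \<longlonglongrightarrow> J"
    by (rule uniform_limit_integral) (auto intro!: continuous_intros f g)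
  have "I n = (\<Sum>i<n. integral {a..b} (\<lambda>t. f t * (g t ^ i / fact i)))" for n
    unfolding integral_unique[OF IJ(1), symmetric]
    by (intro integral_sum integrable_continuous_real continuous_intros f g) auto
  then have "I = (\<lambda>n. \<Sum>i<n. integral {a..b} (\<lambda>t. f t * (g t ^ i / fact i)))"
    by (rule ext)
  then show ?thesis
    unfolding sums_def integral_unique[OF IJ(2)] using IJ(3) by (simp only:)
qed

text \<open>The constant Fourier coefficient of \<open>exp (c z) exp (d / z)\<close> on the unit circle is read off
  the product of the two exponential series.\<close>
lemma integral_exp_Laurent:
  fixes c d :: complex
  shows "integral {-pi..pi} (\<lambda>t. exp (c * exp (\<i> * of_real t) + d * exp (- \<i> * of_real t)))
    = 2 * of_real pi * (\<Sum>n. (c * d) ^ n / fact n ^ 2)"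
proof -
  have inner: "integral {-pi..pi} (\<lambda>t. exp (c * exp (\<i> * of_real t)) * ((d * exp (- \<i> * of_real t)) ^ n / fact n))
      = 2 * of_real pi * ((c * d) ^ n / fact n ^ 2)" for n
  proof -
    \<comment> \<open>The series in \<open>c\<close> is expanded inside the \<open>n\<close>-th term
      of the series in \<open>d\<close>; orthogonality of the exponentials leaves only
      \<open>m = n\<close>.\<close>
    have eq: "integral {-pi..pi} (\<lambda>t. exp (- \<i> * of_real t) ^ n * ((c * exp (\<i> * of_real t)) ^ m / fact m))
        = (if m = n then 2 * of_real pi * (c ^ n / fact n) else 0)" for m
    proof -
      have "exp (- \<i> * of_real t) ^ n * ((c * exp (\<i> * of_real t)) ^ m / fact m)
          = c ^ m / fact m * exp (\<i> * of_int (int m - int n) * of_real t)" for t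
        by (simp add: power_mult_distrib exp_of_nat_mult[symmetric] exp_add[symmetric] algebra_simps)
      then show ?thesis
        by (simp add: integral_exp_int del: of_int_diff)
    qed
    have "(\<lambda>m. if m = n then 2 * of_real pi * (c ^ n / fact n) else 0) sums
        integral {-pi..pi} (\<lambda>t. exp (- \<i> * of_real t) ^ n * exp (c * exp (\<i> * of_real t)))"
      unfolding eq[symmetric] by (intro integral_mult_exp_sums continuous_intros)
    moreover have "(\<lambda>m. if m = n then 2 * of_real pi * (c ^ n / fact n) else 0) sums (2 * of_real pi * (c ^ n / fact n))"
      by (rule sums_single)
    ultimately have "integral {-pi..pi} (\<lambda>t. exp (- \<i> * of_real t) ^ n * exp (c * exp (\<i> * of_real t)))
        = 2 * of_real pi * (c ^ n / fact n)"
      by (rule sums_unique2)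
    moreover have "exp (c * exp (\<i> * of_real t)) * ((d * exp (- \<i> * of_real t)) ^ n / fact n)
        = d ^ n / fact n * (exp (- \<i> * of_real t) ^ n * exp (c * exp (\<i> * of_real t)))" for t
      by (simp add: power_mult_distrib)
    ultimately have "integral {-pi..pi} (\<lambda>t. exp (c * exp (\<i> * of_real t)) * ((d * exp (- \<i> * of_real t)) ^ n / fact n))
        = d ^ n / fact n * (2 * of_real pi * (c ^ n / fact n))"
      by (simp only: Henstock_Kurzweil_Integration.integral_mult_right)
    then show ?thesis
      by (simp add: power_mult_distrib power2_eq_square)
  qed
  have "(\<lambda>n. 2 * of_real pi * ((c * d) ^ n / fact n ^ 2)) sums
      integral {-pi..pi} (\<lambda>t. exp (c * exp (\<i> * of_real t)) * exp (d * exp (- \<i> * of_real t)))"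
    unfolding inner[symmetric] by (intro integral_mult_exp_sums continuous_intros)
  then have s: "(\<lambda>n. 2 * of_real pi * ((c * d) ^ n / fact n ^ 2)) sums
      integral {-pi..pi} (\<lambda>t. exp (c * exp (\<i> * of_real t) + d * exp (- \<i> * of_real t)))"
    by (simp only: exp_add)
  then have "(\<lambda>n. (c * d) ^ n / fact n ^ 2) sums
      (integral {-pi..pi} (\<lambda>t. exp (c * exp (\<i> * of_real t) + d * exp (- \<i> * of_real t))) / (2 * of_real pi))"
    using sums_divide[OF s, of "2 * of_real pi"] by simp
  then show ?thesis
    by (simp add: sums_iff)
qed

lemma integral_exp_trig_bessel:
  fixes a b r :: real
  assumes r: "r ^ 2 = a ^ 2 + b ^ 2"
  shows "integral {-pi..pi} (\<lambda>t. exp (\<i> * of_real (a * sin t + b * cos t)))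
    = 2 * of_real pi * bessel_J0 (of_real r)"
proof -
  \<comment> \<open>By Euler's formula these are the coefficients of \<open>exp (\<i> * t)\<close>
    and \<open>exp (- \<i> * t)\<close> in the exponent. Their product is
    \<open>- (a ^ 2 + b ^ 2) / 4\<close>, the quantity whose powers occur in the series of
    \<open>bessel_J0\<close>.\<close>
  define c d where "c = (of_real a + \<i> * of_real b) / 2" and "d = (- of_real a + \<i> * of_real b) / 2"
  have "\<i> * of_real (a * sin t + b * cos t) = c * exp (\<i> * of_real t) + d * exp (- \<i> * of_real t)" for t
  proof -
    have e: "exp (\<i> * of_real t) = of_real (cos t) + \<i> * of_real (sin t)"
      "exp (- \<i> * of_real t) = of_real (cos t) - \<i> * of_real (sin t)"
      using exp_Euler[of "of_real t"] exp_Euler[of "- of_real t"] by (simp_all add: sin_of_real cos_of_real)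
    show ?thesis
      unfolding e c_def d_def by (simp add: field_simps)
  qed
  moreover have "c * d = - (of_real r ^ 2) / 4"
  proof -
    have "c * d = - of_real (a ^ 2 + b ^ 2) / 4"
      by (simp add: c_def d_def algebra_simps power2_eq_square)
    then show ?thesis
      unfolding r[symmetric] by simp
  qed
  ultimately show ?thesis
    using integral_exp_Laurent[of c d] by (simp add: bessel_J0_def)
qed

text \<open>Changing \<open>t\<close> to \<open>- t\<close> in the second integrand amounts to
  shifting the first one by \<open>pi\<close> or by \<open>- pi\<close>. The second integral thus
  covers the two quarters of the period that the first leaves out.\<close>

lemma integral_exp_trig_half_bessel:
  fixes a b r :: real
  assumes r: "r ^ 2 = a ^ 2 + b ^ 2"
  shows "integral {-pi/2..pi/2} (\<lambda>t. exp (\<i> * of_real (a * sin t + b * cos t)))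
      + integral {-pi/2..pi/2} (\<lambda>t. exp (\<i> * of_real (a * sin t - b * cos t)))
    = 2 * of_real pi * bessel_J0 (of_real r)"
proof -
  define E where "E t = exp (\<i> * of_real (a * sin t + b * cos t))" for t
  define E' where "E' t = exp (\<i> * of_real (a * sin t - b * cos t))" for t
  have c: "continuous_on S E" "continuous_on S E'" for S
    unfolding E_def E'_def by (intro continuous_intros)+
  have i: "E integrable_on {u..v}" "E' integrable_on {u..v}" for u v
    by (intro integrable_continuous_real c)+
  have "integral {0..pi/2} E' = integral {-(pi/2)..-0} (\<lambda>t. E' (- t))"
    by (rule Henstock_Kurzweil_Integration.integral_reflect_real[symmetric])
  also have "(\<lambda>t. E' (- t)) = E \<circ> (\<lambda>t. t + pi)"
    by (auto simp: E_def E'_def)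
  also have "integral {-(pi/2)..-0} (E \<circ> (\<lambda>t. t + pi)) = integral {-(pi/2) + pi..-0 + pi} E"
    by (intro integral_shift c)
  finally have 1: "integral {0..pi/2} E' = integral {pi/2..pi} E"
    by simp
  have "integral {-(pi/2)..0} E' = integral {-0..-(-(pi/2))} (\<lambda>t. E' (- t))"
    by (rule Henstock_Kurzweil_Integration.integral_reflect_real[symmetric])
  also have "(\<lambda>t. E' (- t)) = E \<circ> (\<lambda>t. t + (-pi))"
    by (auto simp: E_def E'_def)
  also have "integral {-0..-(-(pi/2))} (E \<circ> (\<lambda>t. t + (-pi))) = integral {-0 + (-pi)..-(-(pi/2)) + (-pi)} E"
    by (intro integral_shift c)
  finally have 2: "integral {-(pi/2)..0} E' = integral {-pi..-(pi/2)} E"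
    by (simp add: algebra_simps)
  have "integral {-(pi/2)..pi/2} E' = integral {-(pi/2)..0} E' + integral {0..pi/2} E'"
    by (rule Henstock_Kurzweil_Integration.integral_combine[symmetric]) (auto intro: i)
  moreover have "integral {-pi..pi/2} E = integral {-pi..-(pi/2)} E + integral {-(pi/2)..pi/2} E"
    by (rule Henstock_Kurzweil_Integration.integral_combine[symmetric]) (auto intro: i)
  moreover have "integral {-pi..pi} E = integral {-pi..pi/2} E + integral {pi/2..pi} E"
    by (rule Henstock_Kurzweil_Integration.integral_combine[symmetric]) (auto intro: i order_trans[of _ 0])
  ultimately have "integral {-(pi/2)..pi/2} E + integral {-(pi/2)..pi/2} E' = integral {-pi..pi} E"
    unfolding 1 2 by (simp only: add_ac)
  then show ?thesis
    using integral_exp_trig_bessel[OF r] by (simp add: E_def[abs_def] E'_def[abs_def])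
qed

section \<open>The Fourier transform\<close>

text \<open>The exponent has a positive sign and there is no normalising constant, whence the factor
  \<open>2 * pi\<close> in inversion and in Parseval's identity.\<close>

definition fourier :: "(real \<Rightarrow> complex) \<Rightarrow> real \<Rightarrow> complex" where
  "fourier f l = (LINT y|lborel. exp (\<i> * of_real (l * y)) * f y)"

lemma integrable_mult_exp_i:
  assumes "integrable lborel f"
  shows "integrable lborel (\<lambda>y. exp (\<i> * of_real (l * y)) * f y)"
proof (rule Bochner_Integration.integrable_bound[OF assms])
  have "(\<lambda>y. exp (\<i> * complex_of_real (l * y))) \<in> borel_measurable lborel"
    by measurable
  then show "(\<lambda>y. exp (\<i> * of_real (l * y)) * f y) \<in> borel_measurable lborel"
    using assms by (intro borel_measurable_times) auto
qed (simp add: norm_mult)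

lemma measurable_exp_i_mult [measurable]:
  "(\<lambda>z. exp (\<i> * complex_of_real (fst z * snd z))) \<in> borel_measurable (lborel \<Otimes>\<^sub>M lborel)"
proof -
  have "(\<lambda>z. exp (\<i> * complex_of_real (fst z * snd z))) \<in> borel_measurable (borel :: (real \<times> real) measure)"
    by (intro borel_measurable_continuous_onI continuous_intros)
  then show ?thesis
    by (simp add: lborel_prod)
qed

lemma norm_fourier_le: "norm (fourier f l) \<le> (LINT y|lborel. norm (f y))"
  unfolding fourier_def by (rule order_trans[OF integral_norm_bound]) (simp add: norm_mult)

text \<open>The exponential is symmetric in its two variables, so Fubini moves the transform from
  one factor to the other. Inversion and Parseval's identity both rest on this.\<close>

lemma fourier_mult_formula:
  assumes u: "integrable lborel u" and v: "integrable lborel v"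
  shows "(LINT l|lborel. u l * fourier v l) = (LINT y|lborel. fourier u y * v y)"
proof -
  have I: "integrable (lborel \<Otimes>\<^sub>M lborel) (\<lambda>(l, y). exp (\<i> * of_real (l * y)) * u l * v y)"
  proof (rule lborel_pair.Fubini_integrable)
    have [measurable]: "u \<in> borel_measurable lborel" "v \<in> borel_measurable lborel"
      using u v by auto
    show "(\<lambda>(l, y). exp (\<i> * of_real (l * y)) * u l * v y) \<in> borel_measurable (lborel \<Otimes>\<^sub>M lborel)"
      unfolding case_prod_unfold by measurable
    show "integrable lborel (\<lambda>x. LINT y|lborel. norm (case (x, y) of (l, y) \<Rightarrow> exp (\<i> * of_real (l * y)) * u l * v y))"
      using u by (simp add: norm_mult)
    show "AE x in lborel. integrable lborel (\<lambda>y. case (x, y) of (l, y) \<Rightarrow> exp (\<i> * of_real (l * y)) * u l * v y)"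
      using integrable_mult_exp_i[OF v] by (intro AE_I2) (simp add: mult.commute mult.left_commute)
  qed
  have "(LINT l|lborel. u l * fourier v l) = (LINT l|lborel. LINT y|lborel. exp (\<i> * of_real (l * y)) * u l * v y)"
    unfolding fourier_def integral_mult_right_zero[symmetric] by (simp only: ac_simps)
  also have "\<dots> = (LINT y|lborel. LINT l|lborel. exp (\<i> * of_real (l * y)) * u l * v y)"
    by (rule lborel_pair.Fubini_integral[OF I, symmetric])
  also have "\<dots> = (LINT y|lborel. fourier u y * v y)"
    unfolding fourier_def integral_mult_left_zero[symmetric] by (simp only: mult.commute[of "_ :: real"])
  finally show ?thesis .
qed

lemma integrable_gaussian: "integrable lborel (\<lambda>x::real. exp (- x\<^sup>2 / 2))"
  and integral_gaussian: "(LINT x|lborel. exp (- x\<^sup>2 / 2)) = sqrt (2 * pi)"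
proof -
  have eq: "exp (- x\<^sup>2 / 2) = sqrt (2 * pi) * (std_normal_density x * x ^ (2 * 0))" for x :: real
    by (simp add: std_normal_density_def)
  show "integrable lborel (\<lambda>x::real. exp (- x\<^sup>2 / 2))"
    unfolding eq by (intro integrable_mult_right integrable_std_normal_moment)
  show "(LINT x|lborel. exp (- x\<^sup>2 / 2)) = sqrt (2 * pi)"
    unfolding eq integral_mult_right_zero integral_std_normal_moment_even by simp
qed

text \<open>This is the characteristic function of the standard normal distribution, freed from the
  constant of the density.\<close>

lemma fourier_gaussian: "fourier (\<lambda>x. of_real (exp (- x\<^sup>2 / 2))) t = of_real (sqrt (2 * pi) * exp (- t\<^sup>2 / 2))"
proof -
  have "of_real (exp (- t\<^sup>2 / 2)) = (CLINT x|std_normal_distribution. exp (\<i> * of_real (t * x)))"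
    using fun_cong[OF char_std_normal_distribution, of t] by (simp add: char_def)
  also have "\<dots> = (LINT x|lborel. std_normal_density x *\<^sub>R exp (\<i> * of_real (t * x)))"
    by (rule integral_density) (auto intro!: borel_measurable_continuous_onI continuous_intros)
  also have "\<dots> = (LINT x|lborel. of_real (1 / sqrt (2 * pi)) * (exp (\<i> * of_real (t * x)) * of_real (exp (- x\<^sup>2 / 2))))"
    by (simp add: std_normal_density_def scaleR_conv_of_real ac_simps)
  also have "\<dots> = of_real (1 / sqrt (2 * pi)) * fourier (\<lambda>x. of_real (exp (- x\<^sup>2 / 2))) t"
    unfolding fourier_def by (rule integral_mult_right_zero)
  finally show ?thesis
    by (simp add: field_simps)
qed

text \<open>Gaussian regularisation: the integral of \<open>u n l * fourier f l\<close> is taken to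
  its limit in two ways. Through the multiplication formula it averages \<open>f\<close> against
  Gaussians that concentrate at \<open>x\<close>; directly, the damping factor tends to 1 under the
  majorant \<open>norm (fourier f l)\<close>.\<close>

lemma fourier_inversion:
  fixes f :: "real \<Rightarrow> complex"
  assumes f: "integrable lborel f" and c: "continuous_on UNIV f" and B: "\<And>x. norm (f x) \<le> B"
    and F: "integrable lborel (fourier f)"
  shows "fourier (fourier f) (- x) = 2 * of_real pi * f x"
proof -
  define e :: "nat \<Rightarrow> real" where "e n = inverse (real (Suc n))" for n
  have e: "e n > 0" for n
    by (simp add: e_def)
  have e0: "e \<longlonglongrightarrow> 0"
    unfolding e_def by (rule LIMSEQ_inverse_real_of_nat)
  \<comment> \<open>The phase centres the transform at \<open>x\<close>, and damping at scale
    \<open>e n\<close> gives it width \<open>e n\<close>, as \<open>ft\<close> makes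
    explicit.\<close>
  define u where "u n l = exp (- \<i> * of_real (l * x)) * of_real (exp (- (e n * l)\<^sup>2 / 2))" for n l
  have ft: "fourier (u n) y = of_real (sqrt (2 * pi) / e n * exp (- ((y - x) / e n)\<^sup>2 / 2))" for n y
  proof -
    let ?h = "\<lambda>l. exp (\<i> * complex_of_real (l * y)) * u n l"
    have "fourier (u n) y = \<bar>1 / e n\<bar> *\<^sub>R (LINT t|lborel. ?h (0 + 1 / e n * t))"
      unfolding fourier_def using e[of n] lborel_integral_real_affine[of "1 / e n" ?h 0]
      by (simp add: mult.commute)
    also have "(\<lambda>t. ?h (0 + 1 / e n * t)) = (\<lambda>t. exp (\<i> * of_real ((y - x) / e n * t)) * of_real (exp (- t\<^sup>2 / 2)))"
      using e[of n] unfolding u_def mult.assoc[symmetric] exp_add[symmetric]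
      by (simp add: field_simps)
    finally show ?thesis
      using fourier_gaussian[of "(y - x) / e n"] e[of n]
      by (simp add: fourier_def scaleR_conv_of_real)
  qed
  have ui: "integrable lborel (u n)" for n
  proof -
    have "integrable lborel (\<lambda>l. complex_of_real (exp (- (0 + e n * l)\<^sup>2 / 2)))"
      using lborel_integrable_real_affine[OF integrable_gaussian, of "e n" 0] e[of n]
      by (intro integrable_of_real) simp
    from integrable_mult_exp_i[OF this, of "- x"] show ?thesis
      by (simp add: u_def[abs_def] mult.commute)
  qed
  \<comment> \<open>The substitution \<open>y = x + e n * s\<close> cancels the factor
    \<open>1 / e n\<close> from \<open>ft\<close> and leaves \<open>n\<close> only in the argument
    of \<open>f\<close>.\<close>
  have G: "(LINT l|lborel. u n l * fourier f l)
      = (LINT s|lborel. of_real (sqrt (2 * pi) * exp (- s\<^sup>2 / 2)) * f (x + e n * s))" for n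
  proof -
    have "(LINT l|lborel. u n l * fourier f l) = (LINT y|lborel. fourier (u n) y * f y)"
      by (rule fourier_mult_formula[OF ui f])
    also have "\<dots> = \<bar>e n\<bar> *\<^sub>R (LINT s|lborel. fourier (u n) (x + e n * s) * f (x + e n * s))"
      using e[of n] by (intro lborel_integral_real_affine) simp
    also have "\<dots> = (LINT s|lborel. \<bar>e n\<bar> *\<^sub>R (fourier (u n) (x + e n * s) * f (x + e n * s)))"
      by (rule integral_scaleR_right[symmetric])
    also have "(\<lambda>s. \<bar>e n\<bar> *\<^sub>R (fourier (u n) (x + e n * s) * f (x + e n * s)))
        = (\<lambda>s. of_real (sqrt (2 * pi) * exp (- s\<^sup>2 / 2)) * f (x + e n * s))"
      unfolding ft using e[of n] by (auto simp: scaleR_conv_of_real)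
    finally show ?thesis .
  qed
  \<comment> \<open>The limit is stated with \<open>0\<close> in the place of \<open>e n\<close>,
    the shape that \<open>tendsto_intros\<close> produces; it is simplified afterwards.\<close>
  have "(\<lambda>n. LINT s|lborel. of_real (sqrt (2 * pi) * exp (- s\<^sup>2 / 2)) * f (x + e n * s))
      \<longlonglongrightarrow> (LINT s|lborel. of_real (sqrt (2 * pi) * exp (- s\<^sup>2 / 2)) * f (x + 0 * s))"
  proof (rule integral_dominated_convergence[where w = "\<lambda>s. sqrt (2 * pi) * exp (- s\<^sup>2 / 2) * B"])
    have f': "isCont f z" for z
      using c by (simp add: continuous_on_eq_continuous_at)
    show "AE s in lborel. (\<lambda>n. of_real (sqrt (2 * pi) * exp (- s\<^sup>2 / 2)) * f (x + e n * s))
        \<longlonglongrightarrow> of_real (sqrt (2 * pi) * exp (- s\<^sup>2 / 2)) * f (x + 0 * s)"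
      by (intro AE_I2 tendsto_intros isCont_tendsto_compose[OF f'] e0)
    show "AE s in lborel. norm (of_real (sqrt (2 * pi) * exp (- s\<^sup>2 / 2)) * f (x + e n * s))
        \<le> sqrt (2 * pi) * exp (- s\<^sup>2 / 2) * B" for n
      using B by (intro AE_I2) (simp add: norm_mult abs_mult)
    show "integrable lborel (\<lambda>s. sqrt (2 * pi) * exp (- s\<^sup>2 / 2) * B)"
      by (intro integrable_mult_left integrable_mult_right integrable_gaussian)
    have cc: "continuous_on UNIV (\<lambda>s. f (x + d * s))" for d
      by (rule continuous_on_compose2[OF c]) (auto intro!: continuous_intros)
    show "(\<lambda>s. of_real (sqrt (2 * pi) * exp (- s\<^sup>2 / 2)) * f (x + 0 * s)) \<in> borel_measurable lborel"
      "\<And>n. (\<lambda>s. of_real (sqrt (2 * pi) * exp (- s\<^sup>2 / 2)) * f (x + e n * s)) \<in> borel_measurable lborel"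
      unfolding measurable_lborel2 by (intro borel_measurable_continuous_onI continuous_intros cc; simp)+
  qed
  moreover have "(LINT s|lborel. of_real (sqrt (2 * pi) * exp (- s\<^sup>2 / 2)) * f (x + 0 * s)) = 2 * of_real pi * f x"
  proof -
    have "(LINT s|lborel. complex_of_real (sqrt (2 * pi) * exp (- s\<^sup>2 / 2))) = of_real (sqrt (2 * pi) * sqrt (2 * pi))"
      unfolding integral_complex_of_real integral_mult_right_zero integral_gaussian ..
    also have "sqrt (2 * pi) * sqrt (2 * pi) = 2 * pi"
      by simp
    finally show ?thesis
      by (simp only: integral_mult_left_zero mult_zero_left add_0_right) simp
  qed
  ultimately have lim1: "(\<lambda>n. LINT l|lborel. u n l * fourier f l) \<longlonglongrightarrow> 2 * of_real pi * f x"
    unfolding G by (simp only:)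
  have "(\<lambda>n. LINT l|lborel. u n l * fourier f l)
      \<longlonglongrightarrow> (LINT l|lborel. exp (- \<i> * of_real (l * x)) * of_real (exp (- (0 * l)\<^sup>2 / 2)) * fourier f l)"
  proof (rule integral_dominated_convergence[where w = "\<lambda>l. norm (fourier f l)"])
    show "AE l in lborel. (\<lambda>n. u n l * fourier f l)
        \<longlonglongrightarrow> exp (- \<i> * of_real (l * x)) * of_real (exp (- (0 * l)\<^sup>2 / 2)) * fourier f l"
      unfolding u_def by (intro AE_I2 tendsto_intros e0) simp
    show "AE l in lborel. norm (u n l * fourier f l) \<le> norm (fourier f l)" for n
      by (intro AE_I2) (simp add: u_def norm_mult mult_left_le_one_le)
    show "(\<lambda>l. u n l * fourier f l) \<in> borel_measurable lborel" for n
      using ui F by (intro borel_measurable_times) auto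
    show "(\<lambda>l. exp (- \<i> * of_real (l * x)) * of_real (exp (- (0 * l)\<^sup>2 / 2)) * fourier f l) \<in> borel_measurable lborel"
      using integrable_mult_exp_i[OF F, of "- x"] by (simp add: mult.commute)
  qed (use F in auto)
  from LIMSEQ_unique[OF this lim1] show ?thesis
    by (simp add: fourier_def mult.commute)
qed

text \<open>The reflected conjugate of \<open>g\<close> has transform
  \<open>cnj (fourier g l)\<close>. The multiplication formula then turns the left side into an
  integral with the double transform of \<open>f\<close>, which inversion evaluates.\<close>

lemma fourier_parseval:
  fixes f g :: "real \<Rightarrow> complex"
  assumes f: "integrable lborel f" and c: "continuous_on UNIV f" and B: "\<And>x. norm (f x) \<le> B"
    and F: "integrable lborel (fourier f)" and g: "integrable lborel g"
  shows "(LINT l|lborel. fourier f l * cnj (fourier g l)) = 2 * of_real pi * (LINT y|lborel. f y * cnj (g y))"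
proof -
  let ?v = "\<lambda>y. cnj (g (0 + (- 1) * y))"
  have v: "integrable lborel ?v"
    by (intro integrable_cnj lborel_integrable_real_affine[OF g]) simp
  have "fourier ?v l = cnj (fourier g l)" for l
  proof -
    have "cnj (fourier g l) = (LINT y|lborel. exp (- \<i> * of_real (l * y)) * cnj (g y))"
      unfolding fourier_def Bochner_Integration.integral_cnj[symmetric] by (simp add: exp_cnj)
    also have "\<dots> = fourier ?v l"
      unfolding fourier_def
      using lborel_integral_real_affine[of "- 1" "\<lambda>y. exp (- \<i> * of_real (l * y)) * cnj (g y)" 0] by simp
    finally show ?thesis ..
  qed
  then have "(LINT l|lborel. fourier f l * cnj (fourier g l)) = (LINT y|lborel. fourier (fourier f) y * ?v y)"
    using fourier_mult_formula[OF F v] by simp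
  also have "\<dots> = (LINT y|lborel. fourier (fourier f) (- y) * cnj (g y))"
    using lborel_integral_real_affine[of "- 1" "\<lambda>y. fourier (fourier f) y * ?v y" 0] by simp
  also have "\<dots> = 2 * of_real pi * (LINT y|lborel. f y * cnj (g y))"
    unfolding fourier_inversion[OF f c B F] by (simp add: mult.assoc)
  finally show ?thesis .
qed

section \<open>The hyperbolic secant\<close>

definition sech :: "real \<Rightarrow> real" where
  "sech y = 1 / cosh y"

lemma sech_pos [simp]: "sech y > 0" and sech_le_1 [simp]: "sech y \<le> 1"
  using cosh_real_ge_1[of y] by (simp_all add: sech_def)

lemma sech_nonneg [simp]: "sech y \<ge> 0" and sech_neq_0 [simp]: "sech y \<noteq> 0"
  using sech_pos[of y] by linarith+

lemma sech_minus [simp]: "sech (- y) = sech y"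
  by (simp add: sech_def)

lemma tanh_square_plus_sech_square: "(tanh y)\<^sup>2 + (sech y)\<^sup>2 = 1"
  by (simp add: sech_def tanh_def power_divide add_divide_distrib[symmetric] cosh_square_eq[symmetric])

lemma abs_tanh_le_1: "\<bar>tanh (y::real)\<bar> \<le> 1"
  using tanh_real_lt_1[of y] tanh_real_gt_neg1[of y] by (simp add: abs_le_iff)

lemma DERIV_sech [THEN DERIV_chain2, derivative_intros]:
  "(sech has_real_derivative - sech y * tanh y) (at y)"
  unfolding sech_def[abs_def]
  by (auto intro!: derivative_eq_intros simp: tanh_def power2_eq_square)

lemma DERIV_tanh_sech: "(tanh has_real_derivative (sech y)\<^sup>2) (at y)"
  using tanh_square_plus_sech_square[of y]
  by (auto intro!: derivative_eq_intros simp: algebra_simps)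

lemma continuous_on_sech [continuous_intros]:
  "continuous_on S g \<Longrightarrow> continuous_on S (\<lambda>x. sech (g x))"
  unfolding sech_def by (intro continuous_intros) auto

lemma continuous_on_tanh_real [continuous_intros]:
  "continuous_on S g \<Longrightarrow> continuous_on S (\<lambda>x. tanh (g x :: real))"
  by (intro continuous_intros) auto

lemma integrable_sqrt_sech: "integrable lborel (\<lambda>y. sqrt (sech y))"
  using integrable_inverse_sqrt_cosh by (simp add: sech_def real_sqrt_divide)

lemma sqrt_sech_tendsto_0: "((\<lambda>y. sqrt (sech y)) \<longlongrightarrow> 0) at_top" "((\<lambda>y. sqrt (sech y)) \<longlongrightarrow> 0) at_bot"
proof -
  have "((\<lambda>y. sqrt (1 / cosh (y::real))) \<longlongrightarrow> sqrt 0) F" if "filterlim cosh at_top F" for F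
    using tendsto_inverse_0_at_top[OF that] by (intro tendsto_real_sqrt) (simp add: field_simps)
  from this[OF cosh_real_at_top] this[OF cosh_real_at_bot]
  show "((\<lambda>y. sqrt (sech y)) \<longlongrightarrow> 0) at_top" "((\<lambda>y. sqrt (sech y)) \<longlongrightarrow> 0) at_bot"
    by (simp_all add: sech_def)
qed

section \<open>Derivatives and decay of the Fourier transform\<close>

lemma fourier_derivative:
  fixes f f' :: "real \<Rightarrow> complex"
  assumes der: "\<And>y. (f has_vector_derivative f' y) (at y)" and c: "continuous_on UNIV f'"
    and f: "integrable lborel f" and f': "integrable lborel f'"
    and lim: "(f \<longlongrightarrow> 0) at_top" "(f \<longlongrightarrow> 0) at_bot"
  shows "fourier f' l = - \<i> * of_real l * fourier f l"
proof -
  let ?e = "\<lambda>y::real. exp (\<i> * of_real (l * y))"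
  let ?D = "\<lambda>y. ?e y * f' y + \<i> * of_real l * (?e y * f y)"
  have i: "integrable lborel (\<lambda>y. ?e y * f' y)" "integrable lborel (\<lambda>y. \<i> * of_real l * (?e y * f y))"
    using integrable_mult_exp_i[OF f] integrable_mult_exp_i[OF f'] by simp_all
  have cf: "continuous_on UNIV f"
    using der by (meson continuous_at_imp_continuous_on has_vector_derivative_continuous)
  have e: "(?e has_vector_derivative \<i> * of_real l * ?e y) (at y)" for y
    using exp_mult_has_vector_derivative[of "\<i> * of_real l" y UNIV] by (simp add: mult.assoc)
  \<comment> \<open>Integration by parts: \<open>?D\<close> is the derivative of
    \<open>?e y * f y\<close>, which vanishes at both ends.\<close>
  have "(LINT y|lborel. ?D y) = 0"
  proof (rule integral_derivative_eq_0)
    show "((\<lambda>y. ?e y * f y) has_vector_derivative ?D y) (at y)" for y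
      by (rule has_vector_derivative_eq_rhs[OF has_vector_derivative_mult[OF e der]]) simp
    show "continuous_on UNIV ?D"
      by (intro continuous_intros cf c)
    show "integrable lborel ?D"
      by (intro Bochner_Integration.integrable_add i)
    show "((\<lambda>y. ?e y * f y) \<longlongrightarrow> 0) at_top" "((\<lambda>y. ?e y * f y) \<longlongrightarrow> 0) at_bot"
      by (rule tendsto_0_le[OF lim(1), of _ 1] tendsto_0_le[OF lim(2), of _ 1];
        simp add: norm_mult)+
  qed
  then have "fourier f' l + \<i> * of_real l * fourier f l = 0"
    unfolding fourier_def Bochner_Integration.integral_add[OF i] integral_mult_right_zero .
  then show ?thesis
    by (simp add: eq_neg_iff_add_eq_0)
qed

lemma fourier_measurable:
  assumes "integrable lborel f"
  shows "fourier f \<in> borel_measurable lborel"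
proof -
  have [measurable]: "f \<in> borel_measurable lborel"
    using assms by auto
  have "(\<lambda>(l, y). exp (\<i> * of_real (l * y)) * f y) \<in> borel_measurable (lborel \<Otimes>\<^sub>M lborel)"
    unfolding case_prod_unfold by measurable
  then show ?thesis
    unfolding fourier_def[abs_def] by (rule lborel.borel_measurable_lebesgue_integral)
qed

text \<open>Two integrations by parts give \<open>fourier f'' l = - l ^ 2 * fourier f l\<close>.
  Adding the trivial bounds for \<open>fourier f\<close> and \<open>fourier f''\<close> yields decay
  of order \<open>1 / (1 + l ^ 2)\<close>.\<close>

lemma integrable_fourier:
  fixes f f' f'' :: "real \<Rightarrow> complex"
  assumes der: "\<And>y. (f has_vector_derivative f' y) (at y)" "\<And>y. (f' has_vector_derivative f'' y) (at y)"
    and c: "continuous_on UNIV f''"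
    and int: "integrable lborel f" "integrable lborel f'" "integrable lborel f''"
    and lim: "(f \<longlongrightarrow> 0) at_top" "(f \<longlongrightarrow> 0) at_bot" "(f' \<longlongrightarrow> 0) at_top" "(f' \<longlongrightarrow> 0) at_bot"
  shows "integrable lborel (fourier f)"
proof (rule Bochner_Integration.integrable_bound)
  let ?C = "(LINT y|lborel. norm (f y)) + (LINT y|lborel. norm (f'' y))"
  have "integrable lborel (\<lambda>l::real. inverse (1 + l\<^sup>2))"
    using integrable_inverse_1_plus_square by (simp add: set_integrable_def)
  then show "integrable lborel (\<lambda>l::real. ?C * inverse (1 + l\<^sup>2))"
    by simp
  show "fourier f \<in> borel_measurable lborel"
    by (rule fourier_measurable[OF int(1)])
  have "continuous_on UNIV f'"
    using der(2) by (meson continuous_at_imp_continuous_on has_vector_derivative_continuous)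
  then have "fourier f'' l = - of_real (l\<^sup>2) * fourier f l" for l
    using fourier_derivative[OF der(1) _ int(1,2) lim(1,2)] fourier_derivative[OF der(2) c int(2,3) lim(3,4)]
    by (simp add: power2_eq_square algebra_simps)
  then have "norm (fourier f l) * (1 + l\<^sup>2) = norm (fourier f l) + norm (fourier f'' l)" for l
    by (simp add: norm_mult norm_power algebra_simps)
  then have "norm (fourier f l) * (1 + l\<^sup>2) \<le> ?C" for l
    using norm_fourier_le[of f l] norm_fourier_le[of f'' l] by (metis add_mono)
  moreover have "1 + l\<^sup>2 > 0" for l :: real
    by (simp add: add_pos_nonneg)
  ultimately have "norm (fourier f l) \<le> ?C * inverse (1 + l\<^sup>2)" for l
    by (simp add: pos_le_divide_eq flip: divide_inverse)
  then show "AE l in lborel. norm (fourier f l) \<le> norm (?C * inverse (1 + l\<^sup>2))"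
    by (auto intro: order_trans)
qed

section \<open>Linear second-order equations on the real line\<close>

lemma second_order_ode_solution:
  fixes q v v' u1 u1' u2 u2' :: "real \<Rightarrow> complex"
  assumes v: "\<And>x. (v has_vector_derivative v' x) (at x)" "\<And>x. (v' has_vector_derivative q x * v x) (at x)"
    and u1: "\<And>x. (u1 has_vector_derivative u1' x) (at x)" "\<And>x. (u1' has_vector_derivative q x * u1 x) (at x)"
    and u2: "\<And>x. (u2 has_vector_derivative u2' x) (at x)" "\<And>x. (u2' has_vector_derivative q x * u2 x) (at x)"
    and init: "u1 0 = 1" "u1' 0 = 0" "u2 0 = 0" "u2' 0 = 1"
  shows "v x = v 0 * u1 x + v' 0 * u2 x"
proof -
  \<comment> \<open>Without a first-order term in the equation, the Wronskian of two solutions is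
    constant.\<close>
  have W: "f x * g' x - f' x * g x = f 0 * g' 0 - f' 0 * g 0"
    if f: "\<And>x. (f has_vector_derivative f' x) (at x)" "\<And>x. (f' has_vector_derivative q x * f x) (at x)"
      and g: "\<And>x. (g has_vector_derivative g' x) (at x)" "\<And>x. (g' has_vector_derivative q x * g x) (at x)"
    for f f' g g' :: "real \<Rightarrow> complex"
  proof -
    have "((\<lambda>x. f x * g' x - f' x * g x) has_vector_derivative 0) (at x)" for x
      by (rule has_vector_derivative_eq_rhs[OF has_vector_derivative_diff[OF
            has_vector_derivative_mult[OF f(1) g(2)] has_vector_derivative_mult[OF f(2) g(1)]]])
        (simp add: algebra_simps)
    then obtain c where "\<And>x. f x * g' x - f' x * g x = c"
      using has_vector_derivative_zero_constant[of UNIV "\<lambda>x. f x * g' x - f' x * g x"] by auto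
    then show ?thesis by metis
  qed
  show ?thesis
    \<comment> \<open>Cramer's rule: the Wronskians of \<open>v, u2\<close> and of
      \<open>u1, v\<close> are \<open>v 0\<close> and \<open>v' 0\<close>, and that of
      \<open>u1, u2\<close> is 1.\<close>
    using W[OF v u2] W[OF u1 v] W[OF u1 u2] unfolding init by algebra
qed

section \<open>The oscillator kernel\<close>

lemma exp_i_has_vector_derivative:
  assumes "(q has_real_derivative q') (at x)"
  shows "((\<lambda>x. exp (\<i> * of_real (q x))) has_vector_derivative \<i> * of_real q' * exp (\<i> * of_real (q x))) (at x)"
proof -
  have "(q has_vector_derivative q') (at x)"
    using assms by (simp add: has_real_derivative_iff_has_vector_derivative)
  from vector_diff_chain_at[OF this exp_mult_has_vector_derivative[of \<i>]]
  show ?thesis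
    by (simp add: o_def scaleR_conv_of_real mult_ac)
qed

text \<open>The two coefficients are the real and imaginary parts of
  \<open>((\<xi> + \<i> * \<eta>) / 2) ^ 2\<close>.\<close>

definition osc_phase :: "real \<Rightarrow> real \<Rightarrow> real \<Rightarrow> real" where
  "osc_phase \<xi> \<eta> y = (\<xi>\<^sup>2 - \<eta>\<^sup>2) / 4 * tanh y + \<xi> * \<eta> / 2 * sech y"

definition osc_kernel :: "real \<Rightarrow> real \<Rightarrow> real \<Rightarrow> complex" where
  "osc_kernel \<xi> \<eta> y = of_real (sqrt (sech y)) * exp (\<i> * of_real (osc_phase \<xi> \<eta> y))"

lemma norm_osc_kernel: "norm (osc_kernel \<xi> \<eta> y) = sqrt (sech y)"
  by (simp add: osc_kernel_def norm_mult)

lemma continuous_on_osc_kernel [continuous_intros]: "continuous_on S (osc_kernel \<xi> \<eta>)"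
  unfolding osc_kernel_def[abs_def] osc_phase_def by (intro continuous_intros)

text \<open>The modulus \<open>sqrt (sech y)\<close> of the kernel is integrable and vanishes at
  infinity, and a bounded factor preserves both. The \<open>y\<close>-derivatives of the kernel are
  handled through this form.\<close>

lemma osc_kernel_mult:
  assumes m: "continuous_on UNIV m" and B: "\<And>y. norm (m y) \<le> B"
  shows "integrable lborel (\<lambda>y. osc_kernel \<xi> \<eta> y * m y)"
    and "((\<lambda>y. osc_kernel \<xi> \<eta> y * m y) \<longlongrightarrow> 0) at_top"
    and "((\<lambda>y. osc_kernel \<xi> \<eta> y * m y) \<longlongrightarrow> 0) at_bot"
proof -
  have le: "norm (osc_kernel \<xi> \<eta> y * m y) \<le> sqrt (sech y) * B" for y
    unfolding norm_mult norm_osc_kernel by (intro mult_left_mono B) (simp add: less_imp_le)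
  show "integrable lborel (\<lambda>y. osc_kernel \<xi> \<eta> y * m y)"
  proof (rule Bochner_Integration.integrable_bound)
    show "integrable lborel (\<lambda>y. sqrt (sech y) * B)"
      by (intro integrable_mult_left integrable_sqrt_sech)
    show "(\<lambda>y. osc_kernel \<xi> \<eta> y * m y) \<in> borel_measurable lborel"
      unfolding measurable_lborel2 by (intro borel_measurable_continuous_onI continuous_intros m)
  qed (auto intro!: order_trans[OF le])
  show "((\<lambda>y. osc_kernel \<xi> \<eta> y * m y) \<longlongrightarrow> 0) at_top" "((\<lambda>y. osc_kernel \<xi> \<eta> y * m y) \<longlongrightarrow> 0) at_bot"
    using le by (auto intro!: always_eventually tendsto_0_le[OF sqrt_sech_tendsto_0(1), of _ B] tendsto_0_le[OF sqrt_sech_tendsto_0(2), of _ B])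
qed

lemma osc_kernel_has_vector_derivative:
  "(osc_kernel \<xi> \<eta> has_vector_derivative osc_kernel \<xi> \<eta> y *
    (- of_real (tanh y) / 2 + \<i> * of_real ((\<xi>\<^sup>2 - \<eta>\<^sup>2) / 4 * (sech y)\<^sup>2 - \<xi> * \<eta> / 2 * (sech y * tanh y)))) (at y)"
proof -
  have "((\<lambda>y. sqrt (sech y)) has_real_derivative - tanh y / 2 * sqrt (sech y)) (at y)"
  proof -
    have "inverse (sqrt (sech y)) / 2 * (- sech y * tanh y) = - tanh y / 2 * (sech y / sqrt (sech y))"
      by (simp add: inverse_eq_divide mult.commute)
    then have "inverse (sqrt (sech y)) / 2 * (- sech y * tanh y) = - tanh y / 2 * sqrt (sech y)"
      by (simp only: real_div_sqrt[OF sech_nonneg])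
    moreover have "((\<lambda>y. sqrt (sech y)) has_real_derivative inverse (sqrt (sech y)) / 2 * (- sech y * tanh y)) (at y)"
      using DERIV_chain2[OF DERIV_real_sqrt[OF sech_pos] DERIV_sech[OF DERIV_ident], of y] by simp
    ultimately show ?thesis
      by (simp only:)
  qed
  then have 1: "((\<lambda>y. complex_of_real (sqrt (sech y))) has_vector_derivative of_real (- tanh y / 2 * sqrt (sech y))) (at y)"
    by (rule has_vector_derivative_of_real)
  have "(osc_phase \<xi> \<eta> has_real_derivative (\<xi>\<^sup>2 - \<eta>\<^sup>2) / 4 * (sech y)\<^sup>2 - \<xi> * \<eta> / 2 * (sech y * tanh y)) (at y)"
    using DERIV_add[OF DERIV_cmult[OF DERIV_tanh_sech, of "(\<xi>\<^sup>2 - \<eta>\<^sup>2) / 4" y]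
        DERIV_cmult[OF DERIV_sech[OF DERIV_ident], of "\<xi> * \<eta> / 2" y]]
    by (simp add: osc_phase_def[abs_def])
  note 2 = exp_i_has_vector_derivative[OF this]
  show ?thesis
    unfolding osc_kernel_def[abs_def]
    by (rule has_vector_derivative_eq_rhs[OF has_vector_derivative_mult[OF 1 2]]) (simp add: algebra_simps)
qed

text \<open>The first two \<open>y\<close>-derivatives are the kernel times \<open>?m\<close> and
  \<open>?m' + ?m * ?m\<close>, both continuous and bounded. So \<open>osc_kernel_mult\<close>
  supplies the integrability and the limits that \<open>integrable_fourier\<close> asks for.\<close>

lemma integrable_fourier_osc_kernel: "integrable lborel (fourier (osc_kernel \<xi> \<eta>))"
proof -
  define A B where "A = (\<xi>\<^sup>2 - \<eta>\<^sup>2) / 4" and "B = \<xi> * \<eta> / 2"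
  let ?r = "\<lambda>y. A * (sech y)\<^sup>2 - B * (sech y * tanh y)"
  let ?r' = "\<lambda>y. - 2 * A * (sech y)\<^sup>2 * tanh y - B * ((sech y)\<^sup>2 * sech y - sech y * (tanh y)\<^sup>2)"
  let ?m = "\<lambda>y. - complex_of_real (tanh y) / 2 + \<i> * of_real (?r y)"
  let ?m' = "\<lambda>y. - complex_of_real ((sech y)\<^sup>2) / 2 + \<i> * of_real (?r' y)"
  let ?k = "osc_kernel \<xi> \<eta>"
  have d1: "(?k has_vector_derivative ?k y * ?m y) (at y)" for y
    using osc_kernel_has_vector_derivative[of \<xi> \<eta> y] by (simp only: A_def B_def)
  have dr: "(?r has_real_derivative ?r' y) (at y)" for y
    by (rule derivative_eq_intros DERIV_tanh_sech refl | simp add: power2_eq_square algebra_simps)+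
  have dm: "(?m has_vector_derivative ?m' y) (at y)" for y
  proof -
    have "((\<lambda>y. complex_of_real (tanh y)) has_vector_derivative of_real ((sech y)\<^sup>2)) (at y)"
      "((\<lambda>y. complex_of_real (?r y)) has_vector_derivative of_real (?r' y)) (at y)"
      by (rule has_vector_derivative_of_real[OF DERIV_tanh_sech]
          has_vector_derivative_of_real[OF dr])+
    from has_vector_derivative_add[OF has_vector_derivative_divide[OF has_vector_derivative_minus[OF this(1)], of 2]
        has_vector_derivative_mult_right[OF this(2), of \<i>]]
    show ?thesis by simp
  qed
  have d2: "((\<lambda>y. ?k y * ?m y) has_vector_derivative ?k y * (?m' y + ?m y * ?m y)) (at y)" for y
    by (rule has_vector_derivative_eq_rhs[OF has_vector_derivative_mult[OF d1 dm]]) (simp add: algebra_simps)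
  have cm: "continuous_on UNIV ?m" and cm2: "continuous_on UNIV (\<lambda>y. ?m' y + ?m y * ?m y)"
    by (intro continuous_intros; simp)+
  have s: "\<bar>sech y\<bar> \<le> 1" for y
    using sech_pos[of y] sech_le_1[of y] by linarith
  have p: "\<bar>a * b\<bar> \<le> 1" if "\<bar>a\<bar> \<le> 1" "\<bar>b\<bar> \<le> 1" for a b :: real
    using mult_mono[OF that] by (simp add: abs_mult)
  have q: "\<bar>a * b\<bar> \<le> \<bar>a\<bar>" if "\<bar>b\<bar> \<le> 1" for a b :: real
    using mult_left_mono[OF that, of "\<bar>a\<bar>"] by (simp add: abs_mult)
  have r: "\<bar>?r y\<bar> \<le> \<bar>A\<bar> + \<bar>B\<bar>" for y
    unfolding power2_eq_square
    by (intro order_trans[OF abs_triangle_ineq4] add_mono q p s abs_tanh_le_1)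
  have r': "\<bar>?r' y\<bar> \<le> \<bar>- 2 * A\<bar> + (\<bar>B\<bar> + \<bar>B\<bar>)" for y
    unfolding power2_eq_square right_diff_distrib mult.assoc[of "- 2 * A"]
    by (intro order_trans[OF abs_triangle_ineq4] add_mono q p s abs_tanh_le_1)
  have m: "norm (?m y) \<le> 1 + (\<bar>A\<bar> + \<bar>B\<bar>)" for y
    using r[of y] abs_tanh_le_1[of y]
    by (intro order_trans[OF norm_triangle_ineq] add_mono)
      (simp_all add: norm_mult norm_divide del: of_real_diff of_real_mult of_real_power)
  have m': "norm (?m' y) \<le> 1 + (\<bar>- 2 * A\<bar> + (\<bar>B\<bar> + \<bar>B\<bar>))" for y
    using r'[of y] p[OF s[of y] s[of y]]
    by (intro order_trans[OF norm_triangle_ineq] add_mono)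
      (simp_all add: norm_mult norm_divide power2_eq_square del: of_real_diff of_real_mult of_real_power)
  have mm: "norm (?m' y + ?m y * ?m y) \<le> (1 + (\<bar>- 2 * A\<bar> + (\<bar>B\<bar> + \<bar>B\<bar>))) + (1 + (\<bar>A\<bar> + \<bar>B\<bar>)) * (1 + (\<bar>A\<bar> + \<bar>B\<bar>))" for y
    unfolding norm_mult[symmetric]
    by (intro order_trans[OF norm_triangle_ineq] add_mono order_trans[OF norm_mult_ineq] mult_mono m m') auto
  have k: "integrable lborel ?k" "(?k \<longlongrightarrow> 0) at_top" "(?k \<longlongrightarrow> 0) at_bot"
    using osc_kernel_mult[of "\<lambda>_. 1" 1 \<xi> \<eta>] by simp_all
  show ?thesis
    by (rule integrable_fourier[OF d1 d2 _ k(1) osc_kernel_mult(1)[OF cm m] osc_kernel_mult(1)[OF cm2 mm]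
          k(2,3) osc_kernel_mult(2,3)[OF cm m]]) (intro continuous_intros; simp)
qed

text \<open>Each differentiation multiplies the integrand by a polynomial in \<open>x\<close>,
  \<open>\<alpha> y\<close> and \<open>\<beta> y\<close>, which is bounded for bounded
  \<open>x\<close>; a multiple of \<open>norm (w y)\<close> therefore dominates. All that does not
  depend on \<open>x\<close> is collected in \<open>w\<close>.\<close>

lemma quadratic_phase_integral:
  fixes w :: "real \<Rightarrow> complex" and \<alpha> \<beta> :: "real \<Rightarrow> real"
  assumes w: "integrable lborel w"
    and meas [measurable]: "\<alpha> \<in> borel_measurable lborel" "\<beta> \<in> borel_measurable lborel"
    and A: "\<And>y. \<bar>\<alpha> y\<bar> \<le> A" "\<And>y. \<bar>\<beta> y\<bar> \<le> A"
  defines "E \<equiv> \<lambda>x y. w y * exp (\<i> * of_real (x\<^sup>2 * \<alpha> y + x * \<beta> y))"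
    and "s \<equiv> \<lambda>x y. 2 * x * \<alpha> y + \<beta> y"
  shows "((\<lambda>x. LINT y|lborel. E x y) has_vector_derivative
      (LINT y|lborel. \<i> * of_real (s x y) * E x y)) (at x)"
    and "((\<lambda>x. LINT y|lborel. \<i> * of_real (s x y) * E x y) has_vector_derivative
      (LINT y|lborel. (2 * \<i> * of_real (\<alpha> y) - of_real ((s x y)\<^sup>2)) * E x y)) (at x)"
proof -
  have [measurable]: "w \<in> borel_measurable lborel"
    using w by auto
  have [measurable]: "s x \<in> borel_measurable lborel" for x
    unfolding s_def by measurable
  have nE: "norm (E x y) = norm (w y)" for x y
    by (simp add: E_def norm_mult)
  have int: "integrable lborel (\<lambda>y. m y * E x y)"
    if "m \<in> borel_measurable lborel" "\<And>y. norm (m y) \<le> B" for m x B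
  proof (rule Bochner_Integration.integrable_bound)
    show "integrable lborel (\<lambda>y. B * norm (w y))"
      using w by simp
    have [measurable]: "m \<in> borel_measurable lborel" by fact
    show "(\<lambda>y. m y * E x y) \<in> borel_measurable lborel"
      unfolding E_def by measurable
    have "norm (m y * E x y) \<le> B * norm (w y)" for y
      unfolding norm_mult nE by (intro mult_right_mono that) simp
    then show "AE y in lborel. norm (m y * E x y) \<le> norm (B * norm (w y))"
      unfolding real_norm_def by (intro AE_I2 order_trans[OF _ abs_ge_self])
  qed
  have A0: "A \<ge> 0"
    using A(1)[of 0] by linarith
  \<comment> \<open>The bound is uniform over the unit ball about \<open>x\<close>, as the
    domination rule requires; \<open>n1\<close> and \<open>n2\<close> follow from it.\<close>
  have sb: "\<bar>s z y\<bar> \<le> (2 * (\<bar>x\<bar> + 1) + 1) * A" if "\<bar>z - x\<bar> \<le> 1" for x z y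
  proof -
    have "\<bar>z\<bar> \<le> \<bar>x\<bar> + 1"
      using that by linarith
    then have "\<bar>2 * z * \<alpha> y\<bar> \<le> 2 * (\<bar>x\<bar> + 1) * A"
      unfolding abs_mult by (intro mult_mono A) (auto simp: A0)
    then show ?thesis
      using A(2)[of y] unfolding s_def by (simp add: algebra_simps)
  qed
  have dE: "((\<lambda>x. E x y) has_vector_derivative \<i> * of_real (s x y) * E x y) (at x)" for x y
  proof -
    have "((\<lambda>x. x\<^sup>2 * \<alpha> y + x * \<beta> y) has_real_derivative s x y) (at x)"
      unfolding s_def by (auto intro!: derivative_eq_intros)
    from has_vector_derivative_mult_right[OF exp_i_has_vector_derivative[OF this], of "w y"]
    show ?thesis
      unfolding E_def by (simp only: mult_ac)
  qed
  have ds: "((\<lambda>x. \<i> * of_real (s x y)) has_vector_derivative 2 * \<i> * of_real (\<alpha> y)) (at x)" for x y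
  proof -
    have "((\<lambda>x. s x y) has_real_derivative 2 * \<alpha> y) (at x)"
      unfolding s_def by (auto intro!: derivative_eq_intros)
    from has_vector_derivative_mult_right[OF has_vector_derivative_of_real[OF this], of \<i>]
    show ?thesis by (simp add: mult_ac)
  qed
  have dsE: "((\<lambda>x. \<i> * of_real (s x y) * E x y) has_vector_derivative
      (2 * \<i> * of_real (\<alpha> y) - of_real ((s x y)\<^sup>2)) * E x y) (at x)" for x y
    by (rule has_vector_derivative_eq_rhs[OF has_vector_derivative_mult[OF ds dE]])
      (simp add: algebra_simps power2_eq_square)
  have n1: "norm (\<i> * complex_of_real (s z y)) \<le> (2 * (\<bar>x\<bar> + 1) + 1) * A" if "\<bar>z - x\<bar> \<le> 1" for x z y
    using sb[OF that] by (simp add: norm_mult)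
  have n2: "norm (2 * \<i> * complex_of_real (\<alpha> y) - of_real ((s z y)\<^sup>2)) \<le> 2 * A + ((2 * (\<bar>x\<bar> + 1) + 1) * A)\<^sup>2"
    if "\<bar>z - x\<bar> \<le> 1" for x z y
  proof -
    have "(s z y)\<^sup>2 \<le> ((2 * (\<bar>x\<bar> + 1) + 1) * A)\<^sup>2"
      using power_mono[OF sb[OF that, of y] abs_ge_zero, of 2] by simp
    then have "norm (2 * \<i> * complex_of_real (\<alpha> y)) \<le> 2 * A"
      "norm (complex_of_real ((s z y)\<^sup>2)) \<le> ((2 * (\<bar>x\<bar> + 1) + 1) * A)\<^sup>2"
      using A(1)[of y] by (simp_all add: norm_mult norm_power)
    then show ?thesis
      by (intro order_trans[OF norm_triangle_ineq4] add_mono)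
  qed
  have i0: "integrable lborel (\<lambda>y. E x y)" for x
    using int[of "\<lambda>_. 1" 1 x] by simp
  have i1: "integrable lborel (\<lambda>y. \<i> * of_real (s x y) * E x y)" for x
    by (rule int[OF _ n1[of x x]]) simp_all
  have i2: "integrable lborel (\<lambda>y. (2 * \<i> * of_real (\<alpha> y) - of_real ((s x y)\<^sup>2)) * E x y)" for x
    by (rule int[OF _ n2[of x x]]) simp_all
  show "((\<lambda>x. LINT y|lborel. E x y) has_vector_derivative
      (LINT y|lborel. \<i> * of_real (s x y) * E x y)) (at x)"
  proof (rule has_vector_derivative_integral_dominated[OF i0 dE _ _ i1])
    show "norm (\<i> * of_real (s z y) * E z y) \<le> (2 * (\<bar>x\<bar> + 1) + 1) * A * norm (w y)" if "\<bar>z - x\<bar> \<le> 1" for z y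
      unfolding norm_mult[of "\<i> * of_real (s z y)"] nE by (intro mult_right_mono n1 that) simp
  qed (use w in simp)
  show "((\<lambda>x. LINT y|lborel. \<i> * of_real (s x y) * E x y) has_vector_derivative
      (LINT y|lborel. (2 * \<i> * of_real (\<alpha> y) - of_real ((s x y)\<^sup>2)) * E x y)) (at x)"
  proof (rule has_vector_derivative_integral_dominated[OF i1 dsE _ _ i2])
    show "norm ((2 * \<i> * of_real (\<alpha> y) - of_real ((s z y)\<^sup>2)) * E z y)
        \<le> (2 * A + ((2 * (\<bar>x\<bar> + 1) + 1) * A)\<^sup>2) * norm (w y)" if "\<bar>z - x\<bar> \<le> 1" for z y
      unfolding norm_mult[of "2 * \<i> * of_real (\<alpha> y) - of_real ((s z y)\<^sup>2)"] nE
      by (intro mult_right_mono n2 that) simp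
  qed (use w in simp)
qed

text \<open>The exchange changes the sign of the \<open>tanh\<close> term alone, and
  \<open>tanh\<close> is odd while \<open>sech\<close> is even.\<close>

lemma osc_kernel_swap: "osc_kernel \<eta> \<xi> y = osc_kernel \<xi> \<eta> (- y)"
  by (simp add: osc_kernel_def osc_phase_def algebra_simps diff_divide_distrib)

text \<open>Through this symmetry a differential equation in \<eta>, taken at frequency
  \<open>- l\<close>, also serves for \<xi>.\<close>

lemma fourier_osc_kernel_swap: "fourier (osc_kernel \<eta> \<xi>) l = fourier (osc_kernel \<xi> \<eta>) (- l)"
  unfolding fourier_def osc_kernel_swap[of \<eta> \<xi>]
  using lborel_integral_real_affine[of "- 1" "\<lambda>y. exp (\<i> * of_real (- l * y)) * osc_kernel \<xi> \<eta> y" 0]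
  by simp

lemma integrable_osc_kernel: "integrable lborel (osc_kernel \<xi> \<eta>)"
  using osc_kernel_mult(1)[of "\<lambda>_. 1" 1 \<xi> \<eta>] by simp

text \<open>The factor \<open>m\<close> is the logarithmic \<open>y\<close>-derivative of the
  kernel, so the second claim is integration by parts.\<close>

lemma integral_osc_kernel_derivative:
  defines "m \<equiv> \<lambda>\<xi> \<eta> y. - complex_of_real (tanh y) / 2 +
      \<i> * of_real ((\<xi>\<^sup>2 - \<eta>\<^sup>2) / 4 * (sech y)\<^sup>2 - \<xi> * \<eta> / 2 * (sech y * tanh y))"
  shows "integrable lborel (\<lambda>y. osc_kernel \<xi> \<eta> y * m \<xi> \<eta> y)"
    and "fourier (\<lambda>y. osc_kernel \<xi> \<eta> y * m \<xi> \<eta> y) l = - \<i> * of_real l * fourier (osc_kernel \<xi> \<eta>) l"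
proof -
  have cm: "continuous_on UNIV (m \<xi> \<eta>)"
    unfolding m_def by (intro continuous_intros; simp)
  have "norm (m \<xi> \<eta> y) \<le> 1 + (\<bar>(\<xi>\<^sup>2 - \<eta>\<^sup>2) / 4\<bar> + \<bar>\<xi> * \<eta> / 2\<bar>)" for y
  proof -
    have "\<bar>(sech y)\<^sup>2\<bar> \<le> 1" "\<bar>sech y * tanh y\<bar> \<le> 1"
      unfolding abs_mult power2_eq_square by (intro mult_le_one abs_tanh_le_1; simp)+
    then have "\<bar>(\<xi>\<^sup>2 - \<eta>\<^sup>2) / 4 * (sech y)\<^sup>2 - \<xi> * \<eta> / 2 * (sech y * tanh y)\<bar>
        \<le> \<bar>(\<xi>\<^sup>2 - \<eta>\<^sup>2) / 4\<bar> + \<bar>\<xi> * \<eta> / 2\<bar>"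
      by (intro order_trans[OF abs_triangle_ineq4] add_mono; unfold abs_mult[of _ "(sech y)\<^sup>2"] abs_mult[of _ "sech y * tanh y"])
        (rule mult_left_le, simp, simp)+
    then show ?thesis
      unfolding m_def using abs_tanh_le_1[of y]
      by (intro order_trans[OF norm_triangle_ineq] add_mono)
        (simp_all add: norm_mult norm_divide del: of_real_diff of_real_mult of_real_power)
  qed
  then show i: "integrable lborel (\<lambda>y. osc_kernel \<xi> \<eta> y * m \<xi> \<eta> y)"
    by (rule osc_kernel_mult(1)[OF cm])
  show "fourier (\<lambda>y. osc_kernel \<xi> \<eta> y * m \<xi> \<eta> y) l = - \<i> * of_real l * fourier (osc_kernel \<xi> \<eta>) l"
  proof (rule fourier_derivative)
    show "(osc_kernel \<xi> \<eta> has_vector_derivative osc_kernel \<xi> \<eta> y * m \<xi> \<eta> y) (at y)" for y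
      unfolding m_def by (rule osc_kernel_has_vector_derivative)
    show "continuous_on UNIV (\<lambda>y. osc_kernel \<xi> \<eta> y * m \<xi> \<eta> y)"
      by (intro continuous_intros cm)
  qed (use i integrable_osc_kernel osc_kernel_mult(2,3)[of "\<lambda>_. 1" 1 \<xi> \<eta>] in simp_all)
qed

text \<open>Differentiating the kernel twice in \<eta> gives \<open>\<i>\<close> times its
  \<open>y\<close>-derivative minus \<open>\<eta> ^ 2 / 4\<close> times the kernel, and under
  \<open>fourier\<close> the operator \<open>\<i> d/dy\<close> becomes multiplication by
  \<open>l\<close>. The slope at 0 is recorded because it fixes a coefficient of the later
  expansion.\<close>

lemma fourier_osc_kernel_ode:
  obtains K' where
    "\<And>\<eta>. ((\<lambda>\<eta>. fourier (osc_kernel \<xi> \<eta>) l) has_vector_derivative K' \<eta>) (at \<eta>)"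
    "\<And>\<eta>. (K' has_vector_derivative of_real (l - \<eta>\<^sup>2 / 4) * fourier (osc_kernel \<xi> \<eta>) l) (at \<eta>)"
    "K' 0 = \<i> * of_real (\<xi> / 2) * fourier (\<lambda>y. of_real (sech y) * osc_kernel \<xi> 0 y) l"
proof -
  \<comment> \<open>\<open>w\<close> is the part of the integrand without \<eta>;
    \<open>\<alpha>\<close> and \<open>\<beta>\<close> are the coefficients of
    \<open>\<eta> ^ 2\<close> and \<open>\<eta>\<close> in the phase.\<close>
  define w where "w y = exp (\<i> * of_real (l * y)) * osc_kernel \<xi> 0 y" for y
  define \<alpha> \<beta> where "\<alpha> y = - tanh y / 4" and "\<beta> y = \<xi> / 2 * sech y" for y :: real
  define m where "m \<eta> y = - complex_of_real (tanh y) / 2 +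
      \<i> * of_real ((\<xi>\<^sup>2 - \<eta>\<^sup>2) / 4 * (sech y)\<^sup>2 - \<xi> * \<eta> / 2 * (sech y * tanh y))" for \<eta> y
  have w: "integrable lborel w"
    unfolding w_def by (intro integrable_mult_exp_i integrable_osc_kernel)
  have meas: "\<alpha> \<in> borel_measurable lborel" "\<beta> \<in> borel_measurable lborel"
    unfolding \<alpha>_def \<beta>_def measurable_lborel2
    by (intro borel_measurable_continuous_onI continuous_intros; simp)+
  have "\<bar>\<xi>\<bar> * sech y / 2 \<le> 1 + \<bar>\<xi>\<bar>" for y
    using mult_left_mono[OF sech_le_1[of y], of "\<bar>\<xi>\<bar>"] by simp
  then have A: "\<bar>\<alpha> y\<bar> \<le> 1 + \<bar>\<xi>\<bar>" "\<bar>\<beta> y\<bar> \<le> 1 + \<bar>\<xi>\<bar>" for y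
    using abs_tanh_le_1[of y] by (simp_all add: \<alpha>_def \<beta>_def abs_mult)
  have E: "w y * exp (\<i> * of_real (\<eta>\<^sup>2 * \<alpha> y + \<eta> * \<beta> y)) = exp (\<i> * of_real (l * y)) * osc_kernel \<xi> \<eta> y" for \<eta> y
  proof -
    have "osc_phase \<xi> 0 y + (\<eta>\<^sup>2 * \<alpha> y + \<eta> * \<beta> y) = osc_phase \<xi> \<eta> y"
      by (simp add: osc_phase_def \<alpha>_def \<beta>_def field_simps)
    then have "exp (\<i> * of_real (osc_phase \<xi> 0 y)) * exp (\<i> * of_real (\<eta>\<^sup>2 * \<alpha> y + \<eta> * \<beta> y))
        = exp (\<i> * of_real (osc_phase \<xi> \<eta> y))"
      unfolding exp_add[symmetric] distrib_left[symmetric] of_real_add[symmetric] by (simp only:)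
    then show ?thesis
      by (simp only: w_def osc_kernel_def mult.assoc)
  qed
  \<comment> \<open>The pointwise differential equation: replacing \<open>tanh ^ 2\<close> by
    \<open>1 - sech ^ 2\<close> in the square separates \<open>\<eta> ^ 2 / 4\<close> from the terms
    of the \<open>y\<close>-derivative.\<close>
  have second: "(2 * \<i> * of_real (\<alpha> y) - of_real ((2 * \<eta> * \<alpha> y + \<beta> y)\<^sup>2)) * (exp (\<i> * of_real (l * y)) * osc_kernel \<xi> \<eta> y)
      = \<i> * (exp (\<i> * of_real (l * y)) * (osc_kernel \<xi> \<eta> y * m \<eta> y))
        - of_real (\<eta>\<^sup>2 / 4) * (exp (\<i> * of_real (l * y)) * osc_kernel \<xi> \<eta> y)" for \<eta> y
  proof -
    have gen: "2 * \<i> * of_real (- t / 4) - (of_real r + e) = \<i> * (- of_real t / 2 + \<i> * of_real r) - e"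
      for t r :: real and e :: complex
      by (simp add: algebra_simps)
    have t: "(tanh y)\<^sup>2 = 1 - (sech y)\<^sup>2"
      using tanh_square_plus_sech_square[of y] by simp
    have "(2 * \<eta> * \<alpha> y + \<beta> y)\<^sup>2 = (\<eta>\<^sup>2 * (tanh y)\<^sup>2 - 2 * \<xi> * \<eta> * (sech y * tanh y) + \<xi>\<^sup>2 * (sech y)\<^sup>2) / 4"
      by (simp add: \<alpha>_def \<beta>_def power2_eq_square field_simps)
    then have "(2 * \<eta> * \<alpha> y + \<beta> y)\<^sup>2
        = (\<xi>\<^sup>2 - \<eta>\<^sup>2) / 4 * (sech y)\<^sup>2 - \<xi> * \<eta> / 2 * (sech y * tanh y) + \<eta>\<^sup>2 / 4"
      unfolding t by (simp add: field_simps)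
    then have coef: "2 * \<i> * of_real (\<alpha> y) - of_real ((2 * \<eta> * \<alpha> y + \<beta> y)\<^sup>2) = \<i> * m \<eta> y - of_real (\<eta>\<^sup>2 / 4)"
      using gen[of "tanh y"] by (simp only: m_def \<alpha>_def of_real_add)
    show ?thesis
      unfolding coef by (simp add: algebra_simps)
  qed
  have int2: "(LINT y|lborel. (2 * \<i> * of_real (\<alpha> y) - of_real ((2 * \<eta> * \<alpha> y + \<beta> y)\<^sup>2)) *
      (exp (\<i> * of_real (l * y)) * osc_kernel \<xi> \<eta> y)) = of_real (l - \<eta>\<^sup>2 / 4) * fourier (osc_kernel \<xi> \<eta>) l" for \<eta>
  proof -
    have i: "integrable lborel (\<lambda>y. \<i> * (exp (\<i> * of_real (l * y)) * (osc_kernel \<xi> \<eta> y * m \<eta> y)))"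
      "integrable lborel (\<lambda>y. of_real (\<eta>\<^sup>2 / 4) * (exp (\<i> * of_real (l * y)) * osc_kernel \<xi> \<eta> y))"
      unfolding m_def
      by (intro integrable_mult_right integrable_mult_exp_i integrable_osc_kernel integral_osc_kernel_derivative)+
    have "(LINT y|lborel. (2 * \<i> * of_real (\<alpha> y) - of_real ((2 * \<eta> * \<alpha> y + \<beta> y)\<^sup>2)) *
      (exp (\<i> * of_real (l * y)) * osc_kernel \<xi> \<eta> y)) =
      \<i> * fourier (\<lambda>y. osc_kernel \<xi> \<eta> y * m \<eta> y) l - of_real (\<eta>\<^sup>2 / 4) * fourier (osc_kernel \<xi> \<eta>) l"
      unfolding second fourier_def Bochner_Integration.integral_diff[OF i] integral_mult_right_zero ..
    then show ?thesis
      unfolding integral_osc_kernel_derivative(2)[of \<xi> \<eta> l, folded m_def[of \<eta>]]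
      by (simp add: algebra_simps)
  qed
  let ?K' = "\<lambda>\<eta>. LINT y|lborel. \<i> * of_real (2 * \<eta> * \<alpha> y + \<beta> y) * (exp (\<i> * of_real (l * y)) * osc_kernel \<xi> \<eta> y)"
  note D = quadratic_phase_integral[OF w meas A, unfolded E int2]
  have "?K' 0 = (LINT y|lborel. \<i> * of_real (\<xi> / 2) * (exp (\<i> * of_real (l * y)) * (of_real (sech y) * osc_kernel \<xi> 0 y)))"
    by (simp add: \<beta>_def mult_ac)
  also have "\<dots> = \<i> * of_real (\<xi> / 2) * fourier (\<lambda>y. of_real (sech y) * osc_kernel \<xi> 0 y) l"
    unfolding fourier_def by (rule integral_mult_right_zero)
  finally show ?thesis
    using that[of ?K'] D unfolding fourier_def by blast
qed

section \<open>The expansion in oscillator solutions\<close>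

lemma osc_ivp_real_axis:
  assumes "osc_ivp l c0 c1 u"
  shows "((\<lambda>x. u (of_real x)) has_vector_derivative deriv u (of_real x)) (at x)"
    and "((\<lambda>x. deriv u (of_real x)) has_vector_derivative - (l + of_real x ^ 2 / 4) * u (of_real x)) (at x)"
  using osc_ivp_derivs[OF assms] by (auto intro: has_vector_derivative_real_field)

text \<open>The chain rule contributes \<open>\<i> ^ 2 = - 1\<close>, and
  \<open>(\<i> * x) ^ 2 = - x ^ 2\<close>. Together they change \<open>- (l + x ^ 2 / 4)\<close>
  into \<open>l - x ^ 2 / 4\<close>, the coefficient found for the transform of the kernel in
  \<eta>.\<close>

lemma osc_ivp_imaginary_axis:
  assumes u: "osc_ivp l c0 c1 u"
  shows "((\<lambda>x. u (\<i> * of_real x)) has_vector_derivative \<i> * deriv u (\<i> * of_real x)) (at x)"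
    and "((\<lambda>x. \<i> * deriv u (\<i> * of_real x)) has_vector_derivative (l - of_real x ^ 2 / 4) * u (\<i> * of_real x)) (at x)"
proof -
  note [THEN DERIV_chain2, derivative_intros] = osc_ivp_derivs[OF u]
  have "((\<lambda>z. u (\<i> * z)) has_field_derivative \<i> * deriv u (\<i> * z)) (at z)" for z
    by (auto intro!: derivative_eq_intros)
  then show "((\<lambda>x. u (\<i> * of_real x)) has_vector_derivative \<i> * deriv u (\<i> * of_real x)) (at x)"
    by (rule has_vector_derivative_real_field)
  have "((\<lambda>z. \<i> * deriv u (\<i> * z)) has_field_derivative (l - z ^ 2 / 4) * u (\<i> * z)) (at z)" for z
    by (auto intro!: derivative_eq_intros simp: algebra_simps)
  then show "((\<lambda>x. \<i> * deriv u (\<i> * of_real x)) has_vector_derivative (l - of_real x ^ 2 / 4) * u (\<i> * of_real x)) (at x)"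
    by (rule has_vector_derivative_real_field)
qed

text \<open>The transform is expanded once in \<eta> and once in \<xi>. Comparison leaves
  \<open>P \<eta> * u2 \<xi> = R \<xi> * v2 \<eta>\<close>, which must be a constant multiple of
  \<open>u2 \<xi> * v2 \<eta>\<close>; the slope of \<open>R\<close> at 0 determines the
  constant.\<close>

lemma fourier_osc_kernel:
  "fourier (osc_kernel \<xi> \<eta>) l =
    fourier (\<lambda>y. of_real (sqrt (sech y))) l * osc_u1 (of_real l) (of_real \<xi>) * osc_u1 (of_real l) (\<i> * of_real \<eta>)
    + fourier (\<lambda>y. of_real (sech y * sqrt (sech y))) l / 2 * osc_u2 (of_real l) (of_real \<xi>) * osc_u2 (of_real l) (\<i> * of_real \<eta>)"
proof -
  define u1 u2 where "u1 x = osc_u1 (of_real l) (of_real x)" and "u2 x = osc_u2 (of_real l) (of_real x)" for x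
  \<comment> \<open>Dividing by \<open>\<i>\<close> gives \<open>v2\<close> slope 1 at 0 with
    respect to the real variable.\<close>
  define v1 v2 where "v1 x = osc_u1 (of_real l) (\<i> * of_real x)" and "v2 x = osc_u2 (of_real l) (\<i> * of_real x) / \<i>" for x
  define K where "K \<xi> \<eta> = fourier (osc_kernel \<xi> \<eta>) l" for \<xi> \<eta>
  define R where "R \<xi> = \<i> * of_real (\<xi> / 2) * fourier (\<lambda>y. of_real (sech y) * osc_kernel \<xi> 0 y) l" for \<xi>
  \<comment> \<open>\<open>P\<close> is the slope in \<xi> at 0, obtained from the kernel with
    exchanged variables and hence at frequency \<open>- l\<close>.\<close>
  define P where "P \<eta> = \<i> * of_real (\<eta> / 2) * fourier (\<lambda>y. of_real (sech y) * osc_kernel \<eta> 0 y) (- l)" for \<eta>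
  note i1 = osc_ivp_osc_u1[of "of_real l"] and i2 = osc_ivp_osc_u2[of "of_real l"]
  have init: "u1 0 = 1" "deriv (osc_u1 (of_real l)) (of_real 0) = 0" "u2 0 = 0" "deriv (osc_u2 (of_real l)) (of_real 0) = 1"
    "v1 0 = 1" "\<i> * deriv (osc_u1 (of_real l)) (\<i> * of_real 0) = 0" "v2 0 = 0"
    "deriv (osc_u2 (of_real l)) (\<i> * of_real 0) = 1"
    using i1 i2 by (simp_all add: u1_def u2_def v1_def v2_def osc_ivp_def)
  have eta: "K \<xi> \<eta> = K \<xi> 0 * v1 \<eta> + R \<xi> * v2 \<eta>" for \<xi> \<eta>
  proof -
    obtain K' where K':
      "\<And>\<eta>. ((\<lambda>\<eta>. K \<xi> \<eta>) has_vector_derivative K' \<eta>) (at \<eta>)"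
      "\<And>\<eta>. (K' has_vector_derivative of_real (l - \<eta>\<^sup>2 / 4) * K \<xi> \<eta>) (at \<eta>)" "K' 0 = R \<xi>"
      unfolding K_def R_def by (rule fourier_osc_kernel_ode[of \<xi> l]) blast
    have "((\<lambda>x. v1 x) has_vector_derivative \<i> * deriv (osc_u1 (of_real l)) (\<i> * of_real x)) (at x)"
      "((\<lambda>x. \<i> * deriv (osc_u1 (of_real l)) (\<i> * of_real x)) has_vector_derivative of_real (l - x\<^sup>2 / 4) * v1 x) (at x)"
      "((\<lambda>x. v2 x) has_vector_derivative deriv (osc_u2 (of_real l)) (\<i> * of_real x)) (at x)"
      "((\<lambda>x. deriv (osc_u2 (of_real l)) (\<i> * of_real x)) has_vector_derivative of_real (l - x\<^sup>2 / 4) * v2 x) (at x)" for x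
      using osc_ivp_imaginary_axis[OF i1, of x] osc_ivp_imaginary_axis(1)[OF i2, of x, THEN has_vector_derivative_divide, of \<i>]
        osc_ivp_imaginary_axis(2)[OF i2, of x, THEN has_vector_derivative_divide, of \<i>]
      by (simp_all add: v1_def v2_def mult.left_commute)
    from second_order_ode_solution[OF K'(1,2) this init(5-8)] show ?thesis
      unfolding K'(3) .
  qed
  have xi: "K \<xi> \<eta> = K 0 \<eta> * u1 \<xi> + P \<eta> * u2 \<xi>" for \<xi> \<eta>
  proof -
    obtain K' where K':
      "\<And>\<xi>. ((\<lambda>\<xi>. K \<xi> \<eta>) has_vector_derivative K' \<xi>) (at \<xi>)"
      "\<And>\<xi>. (K' has_vector_derivative of_real (- l - \<xi>\<^sup>2 / 4) * K \<xi> \<eta>) (at \<xi>)" "K' 0 = P \<eta>"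
      unfolding K_def P_def fourier_osc_kernel_swap[of _ \<eta>] by (rule fourier_osc_kernel_ode[of \<eta> "- l"]) blast
    have "((\<lambda>x. u1 x) has_vector_derivative deriv (osc_u1 (of_real l)) (of_real x)) (at x)"
      "((\<lambda>x. deriv (osc_u1 (of_real l)) (of_real x)) has_vector_derivative of_real (- l - x\<^sup>2 / 4) * u1 x) (at x)"
      "((\<lambda>x. u2 x) has_vector_derivative deriv (osc_u2 (of_real l)) (of_real x)) (at x)"
      "((\<lambda>x. deriv (osc_u2 (of_real l)) (of_real x)) has_vector_derivative of_real (- l - x\<^sup>2 / 4) * u2 x) (at x)" for x
      using osc_ivp_real_axis[OF i1, of x] osc_ivp_real_axis[OF i2, of x]
      by (simp_all add: u1_def u2_def)
    from second_order_ode_solution[OF K'(1,2) this init(1-4)] show ?thesis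
      unfolding K'(3) .
  qed
  have R0: "R 0 = 0" and P0: "P 0 = 0"
    by (simp_all add: R_def P_def)
  \<comment> \<open>On the axes \<open>R 0 = 0\<close> and \<open>P 0 = 0\<close> reduce the
    transform to \<open>K 0 0 * u1 \<xi>\<close> and \<open>K 0 0 * v1 \<eta>\<close>, so the first
    terms of both expansions agree and cancel.\<close>
  have PR: "P \<eta> * u2 \<xi> = R \<xi> * v2 \<eta>" for \<xi> \<eta>
    using xi[of \<xi> \<eta>] eta[of \<xi> \<eta>] eta[of 0 \<eta>] xi[of \<xi> 0] by (simp add: R0 P0 algebra_simps)
  let ?C = "fourier (\<lambda>y. of_real (sech y * sqrt (sech y))) l"
  \<comment> \<open>Instead of dividing by \<open>u2 \<xi>\<close>, which may vanish, both sides of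
    \<open>PR\<close> are differentiated at \<open>\<xi> = 0\<close>, where \<open>u2\<close> has
    slope 1.\<close>
  have P: "P \<eta> = \<i> / 2 * ?C * v2 \<eta>"
  proof -
    define w where "w y = exp (\<i> * of_real (l * y)) * (osc_kernel 0 0 y * of_real (sech y))" for y
    \<comment> \<open>\<open>?F\<close> is the transform occurring in \<open>R\<close>. Only its
      value at 0 enters the slope of \<open>R\<close>, but the product rule needs \<open>?F\<close>
      to be differentiable there; its phase is quadratic with zero linear term.\<close>
    let ?F = "\<lambda>x. LINT y|lborel. w y * exp (\<i> * of_real (x\<^sup>2 * (tanh y / 4) + x * 0))"
    have "integrable lborel (\<lambda>y. osc_kernel 0 0 y * complex_of_real (sech y))"
      by (rule osc_kernel_mult(1)[of _ 1]) (auto intro!: continuous_intros)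
    then have wi: "integrable lborel w"
      unfolding w_def by (rule integrable_mult_exp_i)
    have tm: "(\<lambda>y::real. tanh y / 4) \<in> borel_measurable lborel"
      unfolding measurable_lborel2 by (intro borel_measurable_continuous_onI continuous_intros; simp)
    have "\<bar>tanh y / 4\<bar> \<le> 1" for y :: real
      using abs_tanh_le_1[of y] by simp
    from quadratic_phase_integral(1)[OF wi tm _ this, of "\<lambda>_. 0" 0]
    obtain F' where F': "(?F has_vector_derivative F') (at 0)"
      by auto
    have F: "fourier (\<lambda>y. of_real (sech y) * osc_kernel \<xi> 0 y) l = ?F \<xi>" for \<xi>
      by (simp add: fourier_def w_def osc_kernel_def osc_phase_def mult_ac)
    have F0: "?F 0 = ?C"
      by (simp add: fourier_def w_def osc_kernel_def osc_phase_def mult_ac)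
    have "((\<lambda>x. \<i> * of_real (x / 2)) has_vector_derivative \<i> / 2) (at 0)"
      using has_vector_derivative_real_field[of "\<lambda>z. \<i> * (z / 2)" "\<i> / 2" 0 UNIV]
      by (auto intro!: derivative_eq_intros)
    from has_vector_derivative_mult[OF this F'] have "(R has_vector_derivative \<i> / 2 * ?C) (at 0)"
      unfolding R_def F F0 by simp
    then have "((\<lambda>\<xi>. R \<xi> * v2 \<eta>) has_vector_derivative \<i> / 2 * ?C * v2 \<eta>) (at 0)"
      by (rule has_vector_derivative_mult_left)
    moreover have "((\<lambda>\<xi>. P \<eta> * u2 \<xi>) has_vector_derivative P \<eta> * deriv (osc_u2 (of_real l)) (of_real 0)) (at 0)"
      unfolding u2_def by (intro has_vector_derivative_mult_right osc_ivp_real_axis(1)[OF i2])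
    ultimately show ?thesis
      unfolding PR init by (auto dest: vector_derivative_unique_at)
  qed
  have "K 0 0 = fourier (\<lambda>y. of_real (sqrt (sech y))) l"
    by (simp add: K_def fourier_def osc_kernel_def osc_phase_def)
  then have "K \<xi> \<eta> = fourier (\<lambda>y. of_real (sqrt (sech y))) l * u1 \<xi> * v1 \<eta> + ?C / 2 * u2 \<xi> * (\<i> * v2 \<eta>)"
    using xi[of \<xi> \<eta>] eta[of 0 \<eta>] by (simp add: P R0 mult_ac)
  then show ?thesis
    by (simp add: K_def u1_def u2_def v1_def v2_def)
qed

section \<open>Conjugation symmetry and the Gamma weights\<close>

lemma cnj_osc_kernel: "cnj (osc_kernel \<xi> \<eta> y) = osc_kernel \<xi> (- \<eta>) (- y)"
  by (simp add: osc_kernel_def osc_phase_def exp_cnj algebra_simps)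

text \<open>Reflecting \<open>y\<close> undoes the conjugation of the exponential, and the kernel
  then differs only in the sign of \<eta>. The conjugate in Parseval's identity can thus be traded
  for a change of sign.\<close>

lemma cnj_fourier_osc_kernel: "cnj (fourier (osc_kernel \<xi> \<eta>) l) = fourier (osc_kernel \<xi> (- \<eta>)) l"
proof -
  have "cnj (fourier (osc_kernel \<xi> \<eta>) l)
      = (LINT y|lborel. exp (- \<i> * of_real (l * y)) * osc_kernel \<xi> (- \<eta>) (- y))"
    unfolding fourier_def Bochner_Integration.integral_cnj[symmetric] cnj_osc_kernel[symmetric]
    by (simp add: exp_cnj)
  also have "\<dots> = fourier (osc_kernel \<xi> (- \<eta>)) l"
    unfolding fourier_def
    using lborel_integral_real_affine[of "- 1" "\<lambda>y. exp (- \<i> * of_real (l * y)) * osc_kernel \<xi> (- \<eta>) (- y)" 0]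
    by simp
  finally show ?thesis .
qed

text \<open>One factor is integrable and the other is bounded by the integral of the modulus of its
  kernel.\<close>

lemma integrable_fourier_mult:
  "integrable lborel (\<lambda>l. fourier (osc_kernel \<xi> \<eta>) l * fourier (osc_kernel \<xi>0 \<eta>0) l)"
proof (rule Bochner_Integration.integrable_bound)
  let ?B = "LINT y|lborel. norm (osc_kernel \<xi>0 \<eta>0 y)"
  show "integrable lborel (\<lambda>l. norm (fourier (osc_kernel \<xi> \<eta>) l) * ?B)"
    by (intro integrable_mult_left integrable_norm integrable_fourier_osc_kernel)
  show "(\<lambda>l. fourier (osc_kernel \<xi> \<eta>) l * fourier (osc_kernel \<xi>0 \<eta>0) l) \<in> borel_measurable lborel"
    by (intro borel_measurable_times fourier_measurable integrable_osc_kernel)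
  show "AE l in lborel. norm (fourier (osc_kernel \<xi> \<eta>) l * fourier (osc_kernel \<xi>0 \<eta>0) l)
      \<le> norm (norm (fourier (osc_kernel \<xi> \<eta>) l) * ?B)"
    unfolding norm_mult real_norm_def
    by (intro AE_I2 order_trans[OF _ abs_ge_self] order_trans[OF mult_left_mono[OF norm_fourier_le]]) auto
qed

text \<open>The case \<open>s = 1 / 2\<close> of the cosh integral, followed below by
  \<open>s = 3 / 2\<close>. The squares of the two transforms are the weights up to
  constants.\<close>

lemma fourier_sqrt_sech:
  "fourier (\<lambda>y. of_real (sqrt (sech y))) l = of_real (sqrt 2 / (2 * sqrt pi) * norm (Gamma (1 / 4 + \<i> * complex_of_real l / 2)) ^ 2)"
proof -
  have "cosh y powr - (1 / 2) = sqrt (sech y)" for y :: real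
    by (simp add: powr_minus powr_half_sqrt sech_def real_sqrt_divide inverse_eq_divide)
  then show ?thesis
    using cosh_integral_eq_norm_Gamma[of "1 / 2" l]
    by (simp add: fourier_def Gamma_one_half_real powr_half_sqrt)
qed

lemma fourier_sech_sqrt_sech:
  "fourier (\<lambda>y. of_real (sech y * sqrt (sech y))) l = of_real (2 * sqrt 2 / sqrt pi * norm (Gamma (3 / 4 + \<i> * complex_of_real l / 2)) ^ 2)"
proof -
  have p: "x powr (3 / 2) = x * sqrt x" if "x > 0" for x :: real
    using that powr_add[of x 1 "1 / 2"] by (simp add: powr_half_sqrt)
  have "cosh y powr - (3 / 2) = sech y * sqrt (sech y)" for y :: real
    unfolding powr_minus p[OF cosh_real_pos] by (simp add: sech_def real_sqrt_divide inverse_eq_divide)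
  then show ?thesis
    using cosh_integral_eq_norm_Gamma[of "3 / 2" l]
    by (simp add: fourier_def Gamma_three_halves p)
qed

lemma osc_u1_minus: "osc_u1 l (- x) = osc_u1 l x"
  by (simp add: osc_u1_kummer)

lemma osc_u2_minus: "osc_u2 l (- x) = - osc_u2 l x"
  by (simp add: osc_u2_kummer)

text \<open>The two moduli multiply to \<open>sech y\<close>, which is exactly the Jacobian of the
  Gudermannian substitution.\<close>

lemma integral_osc_kernel_mult_cnj:
  "(LINT y|lborel. osc_kernel \<xi> \<eta> y * cnj (osc_kernel \<xi>0 \<eta>0 y)) =
    integral {-pi/2..pi/2} (\<lambda>t. exp (\<i> * of_real
      ((\<xi>\<^sup>2 - \<eta>\<^sup>2 - \<xi>0\<^sup>2 + \<eta>0\<^sup>2) / 4 * sin t + (\<xi> * \<eta> - \<xi>0 * \<eta>0) / 2 * cos t)))"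
proof -
  let ?F = "\<lambda>x y. exp (\<i> * complex_of_real
      ((\<xi>\<^sup>2 - \<eta>\<^sup>2 - \<xi>0\<^sup>2 + \<eta>0\<^sup>2) / 4 * x + (\<xi> * \<eta> - \<xi>0 * \<eta>0) / 2 * y))"
  have eq: "osc_kernel \<xi> \<eta> y * cnj (osc_kernel \<xi>0 \<eta>0 y) = (1 / cosh y) *\<^sub>R ?F (tanh y) (1 / cosh y)" for y
  proof -
    have q: "complex_of_real (sqrt (sech y)) * of_real (sqrt (sech y)) = of_real (sech y)"
      unfolding of_real_mult[symmetric] by simp
    have "osc_kernel \<xi> \<eta> y * cnj (osc_kernel \<xi>0 \<eta>0 y)
        = of_real (sech y) * exp (\<i> * of_real (osc_phase \<xi> \<eta> y - osc_phase \<xi>0 \<eta>0 y))"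
      by (simp add: osc_kernel_def exp_cnj right_diff_distrib exp_diff exp_minus field_simps) (simp only: q)
    also have "osc_phase \<xi> \<eta> y - osc_phase \<xi>0 \<eta>0 y
        = (\<xi>\<^sup>2 - \<eta>\<^sup>2 - \<xi>0\<^sup>2 + \<eta>0\<^sup>2) / 4 * tanh y + (\<xi> * \<eta> - \<xi>0 * \<eta>0) / 2 * sech y"
      by (simp add: osc_phase_def field_simps)
    finally show ?thesis
      by (simp only: sech_def scaleR_conv_of_real)
  qed
  have c: "continuous_on UNIV (\<lambda>(x, y). ?F x y)"
    unfolding case_prod_unfold by (intro continuous_intros)
  show ?thesis
    unfolding eq by (rule sech_substitution(2)[OF c])
qed

section \<open>The integral representation of \<open>bessel_J0\<close>\<close>

theorem theorem3p2:
  fixes \<xi> \<eta> \<xi>0 \<eta>0 r :: real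
  assumes r_nonneg: "r \<ge> 0"
    and r_sq: "r ^ 2 = 1 / 4 * ((\<xi> + \<xi>0) ^ 2 + (\<eta> + \<eta>0) ^ 2) * ((\<xi> - \<xi>0) ^ 2 + (\<eta> - \<eta>0) ^ 2)"
  shows "integrable lborel (\<lambda>l::real. complex_of_real (weight_p1 l)
            * osc_u1 (of_real l) (of_real \<xi>) * osc_u1 (of_real l) (\<i> * of_real \<eta>)
            * osc_u1 (of_real l) (of_real \<xi>0) * osc_u1 (of_real l) (\<i> * of_real \<eta>0))
       \<and> integrable lborel (\<lambda>l::real. complex_of_real (weight_p2 l)
            * osc_u2 (of_real l) (of_real \<xi>) * osc_u2 (of_real l) (\<i> * of_real \<eta>)
            * osc_u2 (of_real l) (of_real \<xi>0) * osc_u2 (of_real l) (\<i> * of_real \<eta>0))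
       \<and> bessel_J0 (complex_of_real (1 / 2 * r)) =
           (LINT l|lborel. complex_of_real (weight_p1 l)
            * osc_u1 (of_real l) (of_real \<xi>) * osc_u1 (of_real l) (\<i> * of_real \<eta>)
            * osc_u1 (of_real l) (of_real \<xi>0) * osc_u1 (of_real l) (\<i> * of_real \<eta>0))
         + (LINT l|lborel. complex_of_real (weight_p2 l)
            * osc_u2 (of_real l) (of_real \<xi>) * osc_u2 (of_real l) (\<i> * of_real \<eta>)
            * osc_u2 (of_real l) (of_real \<xi>0) * osc_u2 (of_real l) (\<i> * of_real \<eta>0))"
proof -
  define T1 where "T1 l = complex_of_real (weight_p1 l)
      * osc_u1 (of_real l) (of_real \<xi>) * osc_u1 (of_real l) (\<i> * of_real \<eta>)
      * osc_u1 (of_real l) (of_real \<xi>0) * osc_u1 (of_real l) (\<i> * of_real \<eta>0)" for l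
  define T2 where "T2 l = complex_of_real (weight_p2 l)
      * osc_u2 (of_real l) (of_real \<xi>) * osc_u2 (of_real l) (\<i> * of_real \<eta>)
      * osc_u2 (of_real l) (of_real \<xi>0) * osc_u2 (of_real l) (\<i> * of_real \<eta>0)" for l
  define K where "K x y = fourier (osc_kernel x y)" for x y
  \<comment> \<open>\<open>X\<close> and \<open>Y\<close> are the two terms of
    \<open>fourier_osc_kernel\<close>; \<open>X\<close> is even and \<open>Y\<close> is odd in
    \<open>y\<close>.\<close>
  define X where "X x y l = fourier (\<lambda>y. of_real (sqrt (sech y))) l
      * osc_u1 (of_real l) (of_real x) * osc_u1 (of_real l) (\<i> * of_real y)" for x y l
  define Y where "Y x y l = fourier (\<lambda>y. of_real (sech y * sqrt (sech y))) l / 2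
      * osc_u2 (of_real l) (of_real x) * osc_u2 (of_real l) (\<i> * of_real y)" for x y l
  \<comment> \<open>With this constant the weights are \<open>?c\<close> and \<open>- ?c\<close>
    times the squares of the leading coefficients of \<open>X\<close> and \<open>Y\<close>.\<close>
  let ?c = "1 / (2 * complex_of_real pi ^ 2)"
  have K: "K x y l = X x y l + Y x y l" "K x (- y) l = X x y l - Y x y l" for x y l
    by (simp_all add: K_def X_def Y_def fourier_osc_kernel osc_u1_minus osc_u2_minus)
  have T1: "T1 l = ?c * (X \<xi> \<eta> l * X \<xi>0 \<eta>0 l)" for l
  proof -
    have "(sqrt 2 / (2 * sqrt pi) * g ^ 2) ^ 2 = g ^ 4 / (2 * pi)" for g :: real
      by (simp add: power_mult_distrib power_divide)
    then have "weight_p1 l = 1 / (2 * pi ^ 2) * (sqrt 2 / (2 * sqrt pi) * norm (Gamma (1 / 4 + \<i> * complex_of_real l / 2)) ^ 2) ^ 2"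
      by (simp only: weight_p1_def) (simp add: power2_eq_square power3_eq_cube)
    then have "complex_of_real (weight_p1 l) = ?c * fourier (\<lambda>y. of_real (sqrt (sech y))) l ^ 2"
      unfolding fourier_sqrt_sech by simp
    then show ?thesis
      by (simp add: T1_def X_def power2_eq_square mult_ac)
  qed
  have T2: "T2 l = - ?c * (Y \<xi> \<eta> l * Y \<xi>0 \<eta>0 l)" for l
  proof -
    have "(2 * sqrt 2 / sqrt pi * g ^ 2 / 2) ^ 2 = 2 * g ^ 4 / pi" for g :: real
      by (simp add: power_mult_distrib power_divide)
    then have "weight_p2 l = - (1 / (2 * pi ^ 2)) * (2 * sqrt 2 / sqrt pi * norm (Gamma (3 / 4 + \<i> * complex_of_real l / 2)) ^ 2 / 2) ^ 2"
      by (simp only: weight_p2_def) (simp add: power2_eq_square power3_eq_cube)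
    then have "complex_of_real (weight_p2 l) = - ?c * (fourier (\<lambda>y. of_real (sech y * sqrt (sech y))) l / 2) ^ 2"
      unfolding fourier_sech_sqrt_sech by simp
    then show ?thesis
      by (simp add: T2_def Y_def power2_eq_square mult_ac)
  qed
  have i: "integrable lborel (\<lambda>l. K x y l * K x' y' l)" for x y x' y'
    unfolding K_def by (rule integrable_fourier_mult)
  \<comment> \<open>Polarisation: the products of \<open>X\<close> and of \<open>Y\<close> become
    combinations of products of transforms, whose integrability is known.\<close>
  have XX: "X \<xi> \<eta> l * X \<xi>0 \<eta>0 l = (K \<xi> \<eta> l * K \<xi>0 \<eta>0 l + K \<xi> \<eta> l * K \<xi>0 (- \<eta>0) l
      + K \<xi> (- \<eta>) l * K \<xi>0 \<eta>0 l + K \<xi> (- \<eta>) l * K \<xi>0 (- \<eta>0) l) / 4"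
    and YY: "Y \<xi> \<eta> l * Y \<xi>0 \<eta>0 l = (K \<xi> \<eta> l * K \<xi>0 \<eta>0 l - K \<xi> \<eta> l * K \<xi>0 (- \<eta>0) l
      - K \<xi> (- \<eta>) l * K \<xi>0 \<eta>0 l + K \<xi> (- \<eta>) l * K \<xi>0 (- \<eta>0) l) / 4" for l
    unfolding K(2) unfolding K(1) by (simp_all add: algebra_simps)
  have int1: "integrable lborel T1" and int2: "integrable lborel T2"
    unfolding T1[abs_def] T2[abs_def] XX YY
    by (intro integrable_mult_right integrable_divide Bochner_Integration.integrable_add
        Bochner_Integration.integrable_diff i)+
  have parseval: "(LINT l|lborel. K x y l * cnj (K x' y' l)) =
      2 * of_real pi * integral {-pi/2..pi/2} (\<lambda>t. exp (\<i> * of_real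
        ((x\<^sup>2 - y\<^sup>2 - x'\<^sup>2 + y'\<^sup>2) / 4 * sin t + (x * y - x' * y') / 2 * cos t)))" for x y x' y'
    unfolding K_def integral_osc_kernel_mult_cnj[symmetric]
    by (rule fourier_parseval[where B = 1])
      (auto intro!: integrable_osc_kernel continuous_intros integrable_fourier_osc_kernel
        simp: norm_osc_kernel)
  let ?a = "(\<xi>\<^sup>2 - \<eta>\<^sup>2 - \<xi>0\<^sup>2 + \<eta>0\<^sup>2) / 4" and ?b = "(\<xi> * \<eta> - \<xi>0 * \<eta>0) / 2"
  have cnjK: "cnj (K x y l) = K x (- y) l" for x y l
    unfolding K_def by (rule cnj_fourier_osc_kernel)
  \<comment> \<open>With \<open>X0\<close>, \<open>Y0\<close> for the values at
    \<open>\<xi>0\<close>, \<open>\<eta>0\<close>, the identity is \<open>(X + Y) * (X0 - Y0) + (X -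
    Y) * (X0 + Y0) = 2 * (X * X0 - Y * Y0)\<close>. The mixed products cancel, and the minus sign is
    that of \<open>weight_p2\<close>.\<close>
  have sum: "T1 l + T2 l = ?c / 2 * (K \<xi> \<eta> l * cnj (K \<xi>0 \<eta>0 l) + K \<xi> (- \<eta>) l * cnj (K \<xi>0 (- \<eta>0) l))" for l
    unfolding T1 T2 cnjK minus_minus unfolding K(2) unfolding K(1) by (simp add: field_simps)
  have "(LINT l|lborel. T1 l) + (LINT l|lborel. T2 l) = (LINT l|lborel. T1 l + T2 l)"
    by (rule Bochner_Integration.integral_add[symmetric]) (rule int1, rule int2)
  also have "\<dots> = ?c / 2 * ((LINT l|lborel. K \<xi> \<eta> l * cnj (K \<xi>0 \<eta>0 l))
      + (LINT l|lborel. K \<xi> (- \<eta>) l * cnj (K \<xi>0 (- \<eta>0) l)))"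
    unfolding sum integral_mult_right_zero cnjK
    by (subst Bochner_Integration.integral_add[OF i i]) (rule refl)
  also have "\<dots> = ?c / 2 * (2 * of_real pi * (
      integral {-pi/2..pi/2} (\<lambda>t. exp (\<i> * of_real (?a * sin t + ?b * cos t)))
      + integral {-pi/2..pi/2} (\<lambda>t. exp (\<i> * of_real (?a * sin t - ?b * cos t)))))"
  proof -
    have "(\<xi>\<^sup>2 - (- \<eta>)\<^sup>2 - \<xi>0\<^sup>2 + (- \<eta>0)\<^sup>2) / 4 * sin t + (\<xi> * (- \<eta>) - \<xi>0 * (- \<eta>0)) / 2 * cos t
        = ?a * sin t - ?b * cos t" for t
      by (simp add: field_simps)
    then show ?thesis
      unfolding parseval distrib_left by (simp only:)
  qed
  also have "\<dots> = ?c / 2 * (2 * of_real pi * (2 * of_real pi * bessel_J0 (of_real (1 / 2 * r))))"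
  proof -
    \<comment> \<open>\<open>?a\<close> and \<open>?b\<close> are the real and imaginary parts of
      \<open>((\<xi> + \<i> * \<eta>) ^ 2 - (\<xi>0 + \<i> * \<eta>0) ^ 2) / 4\<close>; factoring
      this difference of squares gives the two brackets of \<open>r ^ 2\<close>.\<close>
    have "(1 / 2 * r) ^ 2 = ?a ^ 2 + ?b ^ 2"
      unfolding power_mult_distrib r_sq by (simp add: power2_eq_square field_simps)
    then show ?thesis
      by (subst integral_exp_trig_half_bessel) (assumption, rule refl)
  qed
  also have "\<dots> = bessel_J0 (of_real (1 / 2 * r))"
    by (simp add: field_simps power2_eq_square)
  finally have "bessel_J0 (of_real (1 / 2 * r)) = (LINT l|lborel. T1 l) + (LINT l|lborel. T2 l)" ..
  then show ?thesis
    using int1 int2 unfolding T1_def[abs_def] T2_def[abs_def] by blast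
qed

thm_deps theorem3p2

end
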